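(* Let $L$ be an oriented link in $S^3$, $D$ a diagram of $L$, and $N$ the number of components of $L$. Let $\ddot{\mathcal H}_{i,j}(L)$ be the homogeneous component of degree $j$ of $\ddot{\mathcal H}_i(L)$, and let $\mathcal H^{k,l}(L)$ be Khovanov homology in homological degree $k$ and quantum degree $l$. Then for each $i\in\{0,1\}$ and $j\in 2\mathbb Z$ there are isomorphisms of abelian groups $$\ddot{\mathcal H}_{i,j}(L)\cong\bigoplus_{k\in 2\mathbb Z+i}\mathcal H^{k,-\frac j2}(L)\quad\text{if } j\in 4\mathbb Z,\qquad \ddot{\mathcal H}_{i,j}(L)\cong\bigoplus_{k\in 2\mathbb Z+i+1}\mathcal H^{k,-\frac j2}(L)\quad\text{if } j\notin 4\mathbb Z.$$ Furthermore, for each $i\in\{0,1\}$ and $j\in 2\mathbb Z$, $$\ddot{\mathcal H}_{i,j}(L)\cong\bigoplus_{k\in 2\mathbb Z+i+n_+(D)+|s_A|}\mathcal H^{k,-\frac j2}(L),$$ and: (a) if $N$ is odd, then $n_+(D)+|s_A|$ is odd and $\ddot{\mathcal H}_{i,j}(L)=0$ for each $i\in\{0,1\}$ and $j\in 4\mathbb Z$; (b) if $N$ is even, then $n_+(D)+|s_A|$ is even and $\ddot{\mathcal H}_{i,j}(L)=0$ for each $i\in\{0,1\}$ and $j\in 4\mathbb Z+2$.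
   Context: Links are in $S^3$ and diagrams are planar. Graded abelian groups are $\mathbb Z$-graded, morphisms have degree $0$, and $G\{l\}$ is the shift $(G\{l\})_j=G_{j-l}$ (applied to a $2$-complex, both groups are shifted). For $i\in\{0,1\}$ write $\underline i=1-i$. A $2$-complex of graded abelian groups is $(A_0,A_1,\partial_0,\partial_1)$ with $\partial_0:A_0\to A_1$, $\partial_1:A_1\to A_0$ degree-$0$ homomorphisms with $\partial_1\partial_0=0$ and $\partial_0\partial_1=0$. Its homology is $H_*(A)=(H_0(A),H_1(A))$ with $H_i(A)=\ker\partial_i/\operatorname{im}\partial_{\underline i}$. The reflexed $2$-complex is $A^\spadesuit=(A_1,A_0,\partial_1,\partial_0)$, and for an integer $n$, $A^{\spadesuit(n)}$ is $A$ if $n$ is even and $A^\spadesuit$ if $n$ is odd. Let $W$ be the free graded abelian group with basis $w_+$ in degree $2$ and $w_-$ in degree $-2$. Define degree-$2$ maps $\bar m:W\otimes W\to W$, $w_-\otimes w_-\mapsto w_-$, $w_+\otimes w_-\mapsto w_+$, $w_-\otimes w_+\mapsto w_+$, $w_+\otimes w_+\mapsto 0$; and $\bar\Delta:W\to W\otimes W$, $w_-\mapsto w_+\otimes w_-+w_-\otimes w_+$, $w_+\mapsto w_+\otimes w_+$. A Kauffman state $s$ of a diagram $D$ (orientation ignored) marks each crossing with $A$ (or $0$) or $B$ (or $1$). Splitting each crossing according to its mark (the $A$-splitting joins the two regions swept by the overcrossing strand when rotated counterclockwise towards the undercrossing strand, the $B$-splitting joins the other two) gives a collection $D_s$ of $|s|$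 disjoint circles. $a(s)$, $b(s)$ are the numbers of crossings marked $A$, $B$; $s_A$ is the state with all marks $A$. Put $W_s(D)=\big(\bigotimes_{\text{circles of }D_s}W\big)\{a(s)-b(s)\}$, and for $i\in\{0,1\}$ $$\langle\!\langle D\rangle\!\rangle_i=\bigoplus_{s:\ b(s)+|s_A|\in 2\mathbb Z+i}W_s(D).$$ An edge $\xi:s_0\to s_1$ is a pair of states differing at exactly one crossing, marked $A$ in $s_0$ and $B$ in $s_1$; $|\xi|=b(s_0)$. Passing from $D_{s_0}$ to $D_{s_1}$ either merges two circles into one or splits one circle into two; $\partial_\xi:W_{s_0}(D)\to W_{s_1}(D)$ (degree $0$ after the shifts) is $\bar m$, respectively $\bar\Delta$, on the factors of these circles and the identity on all other factors. Given an order of the crossings, $(-1)^\xi$ is $-1$ to the number of crossings marked $B$ in $s_0$ that precede the changing crossing. Set $\partial_i=\sum_{\xi:\ |\xi|+|s_A|\in 2\mathbb Z+i}(-1)^\xi\partial_\xi:\langle\!\langle D\rangle\!\rangle_i\to\langle\!\langle D\rangle\!\rangle_{\underline i}$ and $\langle\!\langle D\rangle\!\rangle=(\langle\!\langle D\rangle\!\rangle_0,\langle\!\langle D\rangle\!\rangle_1,\partial_0,\partial_1)$, a $2$-complex of graded abelian groups. For an oriented diagram $D$, $n_+(D)$ and $n_-(D)$ are the numbers of positive and negative crossings (for a positive crossing the $A$-splitting is the one compatible with the orientation), $w(D)=n_+(D)-n_-(D)$, and $\ddot C(D)=\langle\!\langle D\rangle\!\rangle^{\spadesuit(w(D))}\{-3w(D)\}$.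 For an oriented link $L$, $\ddot{\mathcal H}_*(L)=H_*(\ddot C(D))$ for any diagram $D$ of $L$ (up to isomorphism independent of $D$ and of the order of crossings). Khovanov homology $\mathcal H^{*}(L)$ (integral, Bar-Natan's conventions): let $V$ be free on $v_+$ (degree $1$) and $v_-$ (degree $-1$), $m:V\otimes V\to V$, $v_+\otimes v_+\mapsto v_+$, $v_\pm\otimes v_\mp\mapsto v_-$, $v_-\otimes v_-\mapsto0$, $\Delta:V\to V\otimes V$, $v_+\mapsto v_+\otimes v_-+v_-\otimes v_+$, $v_-\mapsto v_-\otimes v_-$. Put $V_s(D)=\big(\bigotimes_{\text{circles of }D_s}V\big)\{b(s)\}$, $[\![D]\!]^k=\bigoplus_{b(s)=k}V_s(D)$, with differential $\hat d^k=\sum_{|\xi|=k}(-1)^\xi d_\xi$, where $d_\xi$ is $m$ for a merge and $\Delta$ for a split (identity on other factors). Then $\mathcal H^{k,l}(L)$ is the degree-$\big(l-n_+(D)+2n_-(D)\big)$ part of the $(k+n_-(D))$-th cohomology of $([\![D]\!]^*,\hat d)$. *)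

theory Defs
  imports "HOL-Algebra.Free_Abelian_Groups" "HOL-Algebra.Elementary_Groups"
begin

section \<open>Oriented planar link diagrams\<close>

text \<open>
  A link diagram is given in the style of a planar diagram code, that is, as a 4-valent plane
  graph with crossing data and possibly some circles without crossings. The crossings are
  \<open>0, \<dots>, crossings D - 1\<close>; their numbering is also the order of the crossings that fixes the
  signs in the cube of resolutions. The four edge ends (darts) at a crossing \<open>c\<close> are
  \<open>(c, 0), \<dots>, (c, 3)\<close>, listed counterclockwise, where \<open>(c, 0)\<close> is the end at which the
  undercrossing strand enters the crossing. So this strand runs from \<open>(c, 0)\<close> to \<open>(c, 2)\<close>, and
  the overcrossing strand runs from \<open>(c, 3)\<close> to \<open>(c, 1)\<close> if the crossing is positive and from
  \<open>(c, 1)\<close> to \<open>(c, 3)\<close> if it is negative. The involution \<open>glue D\<close> exchanges the two ends of each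
  edge. The number of crossingless circles is \<open>free_circles D\<close>.

  The relative position in the plane of the different connected pieces of the diagram, and the
  orientation of the crossingless circles, are not recorded: none of the notions below depends
  on them.
\<close>

type_synonym dart = "nat \<times> nat"

record link_diagram =
  crossings :: nat
  glue :: "dart \<Rightarrow> dart"
  positive :: "nat \<Rightarrow> bool"
  free_circles :: nat

definition darts :: "link_diagram \<Rightarrow> dart set" where
  "darts D = {..<crossings D} \<times> {..<4}"

fun rotate_dart :: "dart \<Rightarrow> dart" where
  "rotate_dart (c, p) = (c, (p + 1) mod 4)"

fun opposite :: "dart \<Rightarrow> dart" where
  "opposite (c, p) = (c, (p + 2) mod 4)"

text \<open>The strand through the dart leaves the crossing along it.\<close>

fun outgoing :: "link_diagram \<Rightarrow> dart \<Rightarrow> bool" where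
  "outgoing D (c, p) \<longleftrightarrow> p = 2 \<or> p = (if positive D c then 1 else 3)"

text \<open>
  The points of \<open>X\<close> reachable from \<open>x\<close> by applying maps from \<open>F\<close>. It is used only for finite
  \<open>X\<close> and permutations of \<open>X\<close>, so these are the orbits of the group generated by \<open>F\<close>.
\<close>

definition orb :: "('a \<Rightarrow> 'a) set \<Rightarrow> 'a set \<Rightarrow> 'a \<Rightarrow> 'a set" where
  "orb F X x = {(z, f z) | z f. z \<in> X \<and> f \<in> F}\<^sup>* `` {x}"

definition orbs :: "('a \<Rightarrow> 'a) set \<Rightarrow> 'a set \<Rightarrow> 'a set set" where
  "orbs F X = orb F X ` X"

text \<open>The boundary walks of the faces, and the connected pieces of the 4-valent graph.\<close>

definition faces :: "link_diagram \<Rightarrow> dart set set" where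
  "faces D = orbs {rotate_dart \<circ> glue D} (darts D)"

definition pieces :: "link_diagram \<Rightarrow> dart set set" where
  "pieces D = orbs {rotate_dart, glue D} (darts D)"

text \<open>
  Planarity says that each connected piece has Euler characteristic \<open>V - E + F = 2\<close>, where
  \<open>E = 2 V\<close>. (Each piece has \<open>V - E + F \<le> 2\<close>, so it suffices to add up over the pieces.)
\<close>

definition oriented_link_diagram :: "link_diagram \<Rightarrow> bool" where
  "oriented_link_diagram D \<longleftrightarrow>
     (\<forall>d\<in>darts D. glue D d \<in> darts D \<and> glue D (glue D d) = d \<and>
                  (outgoing D (glue D d) \<longleftrightarrow> \<not> outgoing D d)) \<and>
     card (faces D) = crossings D + 2 * card (pieces D)"

definition n_plus :: "link_diagram \<Rightarrow> nat" where
  "n_plus D = card {c. c < crossings D \<and> positive D c}"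

definition n_minus :: "link_diagram \<Rightarrow> nat" where
  "n_minus D = card {c. c < crossings D \<and> \<not> positive D c}"

definition writhe :: "link_diagram \<Rightarrow> int" where
  "writhe D = int (n_plus D) - int (n_minus D)"

definition num_components :: "link_diagram \<Rightarrow> nat" where
  "num_components D = card (orbs {glue D, opposite} (darts D)) + free_circles D"


section \<open>Kauffman states\<close>

text \<open>
  A Kauffman state is encoded by the set of crossings marked \<open>B\<close>; thus \<open>b(s) = card s\<close> and the
  all-\<open>A\<close> state is the empty set. Rotated counterclockwise, the overcrossing strand sweeps
  the region between darts 1 and 2 and the one between darts 3 and 0. Hence the \<open>A\<close>-splitting
  connects dart 0 with 1 and dart 2 with 3, and the \<open>B\<close>-splitting connects 0 with 3 and 1 with 2.
\<close>

type_synonym state = "nat set"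

definition states :: "link_diagram \<Rightarrow> state set" where
  "states D = Pow {..<crossings D}"

fun splitting :: "state \<Rightarrow> dart \<Rightarrow> dart" where
  "splitting s (c, p) = (c, if c \<in> s then 3 - p else if even p then p + 1 else p - 1)"

type_synonym circle = "dart set + nat"

definition circles :: "link_diagram \<Rightarrow> state \<Rightarrow> circle set" where
  "circles D s = orbs {glue D, splitting s} (darts D) <+> {..<free_circles D}"

definition circle_at :: "link_diagram \<Rightarrow> state \<Rightarrow> dart \<Rightarrow> circle" where
  "circle_at D s d = Inl (orb {glue D, splitting s} (darts D) d)"

definition num_a :: "link_diagram \<Rightarrow> state \<Rightarrow> nat" where
  "num_a D s = crossings D - card s"

definition num_b :: "state \<Rightarrow> nat" where
  "num_b s = card s"

definition size_sA :: "link_diagram \<Rightarrow> nat" where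
  "size_sA D = card (circles D {})"


section \<open>Graded abelian groups\<close>

text \<open>A graded abelian group is the family of its homogeneous components.\<close>

type_synonym 'a graded_group = "int \<Rightarrow> 'a monoid"

definition shift :: "'a graded_group \<Rightarrow> int \<Rightarrow> 'a graded_group" where
  "shift G l = (\<lambda>j. G (j - l))"

definition graded_sum :: "'i set \<Rightarrow> ('i \<Rightarrow> 'a graded_group) \<Rightarrow> ('i \<Rightarrow> 'a) graded_group" where
  "graded_sum I G = (\<lambda>j. sum_group I (\<lambda>i. G i j))"

text \<open>
  The homology \<open>ker f / im g\<close> at the middle group of \<open>Z \<rightarrow> A \<rightarrow> B\<close> with maps \<open>g\<close> and \<open>f\<close>.
\<close>

definition homology_at ::
    "'z monoid \<Rightarrow> ('z \<Rightarrow> 'a) \<Rightarrow> 'a monoid \<Rightarrow> ('a \<Rightarrow> 'b) \<Rightarrow> 'b monoid \<Rightarrow> 'a set monoid" where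
  "homology_at Z g A f B = (A\<lparr>carrier := kernel A B f\<rparr>) Mod (g ` carrier Z)"

text \<open>
  The boundary maps of a 2-complex have degree 0; \<open>bdry0 A j\<close> is the component in degree \<open>j\<close>.
\<close>

record 'a two_complex =
  part0 :: "'a graded_group"
  part1 :: "'a graded_group"
  bdry0 :: "int \<Rightarrow> 'a \<Rightarrow> 'a"
  bdry1 :: "int \<Rightarrow> 'a \<Rightarrow> 'a"

definition homology2 :: "'a two_complex \<Rightarrow> nat \<Rightarrow> 'a set graded_group" where
  "homology2 A i = (\<lambda>j.
     if i = 0 then homology_at (part1 A j) (bdry1 A j) (part0 A j) (bdry0 A j) (part1 A j)
     else homology_at (part0 A j) (bdry0 A j) (part1 A j) (bdry1 A j) (part0 A j))"

definition reflex :: "'a two_complex \<Rightarrow> 'a two_complex" where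
  "reflex A = \<lparr>part0 = part1 A, part1 = part0 A, bdry0 = bdry1 A, bdry1 = bdry0 A\<rparr>"

definition reflex_pow :: "'a two_complex \<Rightarrow> int \<Rightarrow> 'a two_complex" where
  "reflex_pow A n = (if even n then A else reflex A)"

definition shift2 :: "'a two_complex \<Rightarrow> int \<Rightarrow> 'a two_complex" where
  "shift2 A l =
     \<lparr>part0 = shift (part0 A) l, part1 = shift (part1 A) l,
      bdry0 = (\<lambda>j. bdry0 A (j - l)), bdry1 = (\<lambda>j. bdry1 A (j - l))\<rparr>"


section \<open>The cube of resolutions\<close>

text \<open>
  A free graded abelian group on a finite set of homogeneous generators (the type \<open>'g\<close>), with a
  multiplication and a comultiplication given on generators. The tensor square of the free
  group on \<open>'g\<close> is the free group on \<open>'g \<times> 'g\<close>. In the same way, its tensor power over a finite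
  set \<open>X\<close> of factors is the free group on the families of generators \<open>x :: X \<rightarrow> 'g\<close>, where \<open>x\<close>
  stands for the pure tensor with factors \<open>x c\<close>, whose degree is the sum of the degrees of these.
\<close>

record 'g graded_alg =
  gdeg :: "'g \<Rightarrow> int"
  gmult :: "'g \<times> 'g \<Rightarrow> ('g \<Rightarrow>\<^sub>0 int)"
  gcomult :: "'g \<Rightarrow> ('g \<times> 'g \<Rightarrow>\<^sub>0 int)"

definition tensor_power ::
    "'g graded_alg \<Rightarrow> 'c set \<Rightarrow> (('c \<Rightarrow> 'g) \<Rightarrow>\<^sub>0 int) graded_group" where
  "tensor_power F X =
     (\<lambda>j. free_Abelian_group {x \<in> X \<rightarrow>\<^sub>E UNIV. (\<Sum>c\<in>X. gdeg F (x c)) = j})"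

type_synonym 'g tensor = "(circle \<Rightarrow> 'g) \<Rightarrow>\<^sub>0 int"

text \<open>
  The map of the edge from \<open>s\<close> to \<open>t = insert c s\<close>. For both splittings, the circles passing by
  the crossing \<open>c\<close> are those through the darts \<open>(c, 0)\<close> and \<open>(c, 2)\<close>. If these are two
  circles for \<open>s\<close>, then they are merged. Otherwise the one circle is split (in a planar diagram
  the two circles for \<open>t\<close> are then distinct). All other circles are the same for \<open>s\<close> and \<open>t\<close>.
\<close>

definition edge_map ::
    "'g graded_alg \<Rightarrow> link_diagram \<Rightarrow> state \<Rightarrow> nat \<Rightarrow> 'g tensor \<Rightarrow> 'g tensor" where
  "edge_map F D s c =
     (let t = insert c s;
          p = circle_at D s (c, 0); q = circle_at D s (c, 2);
          p' = circle_at D t (c, 0); q' = circle_at D t (c, 2)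
      in frag_extend (\<lambda>x.
           if p \<noteq> q
           then frag_extend
                  (\<lambda>g. frag_of (\<lambda>e\<in>circles D t. if e = p' then g else x e))
                  (gmult F (x p, x q))
           else frag_extend
                  (\<lambda>(g, h). frag_of (\<lambda>e\<in>circles D t. if e = p' then g else if e = q' then h else x e))
                  (gcomult F (x p))))"

definition edge_sign :: "state \<Rightarrow> nat \<Rightarrow> int" where
  "edge_sign s c = (-1) ^ card {x \<in> s. x < c}"

text \<open>
  The signed sum of all edge maps ending in a state in \<open>T\<close>, on elements of a direct sum over states.
  The edges ending in \<open>t\<close> start in the states \<open>t - {c}\<close> with \<open>c \<in> t\<close>.
\<close>

definition cube_map ::
    "'g graded_alg \<Rightarrow> link_diagram \<Rightarrow> state set \<Rightarrow> (state \<Rightarrow> 'g tensor) \<Rightarrow> (state \<Rightarrow> 'g tensor)" where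
  "cube_map F D T u =
     (\<lambda>t\<in>T. \<Sum>c\<in>t. frag_cmul (edge_sign (t - {c}) c) (edge_map F D (t - {c}) c (u (t - {c}))))"


section \<open>The 2-complex of a diagram\<close>

datatype wgen = w_plus | w_minus

fun w_deg :: "wgen \<Rightarrow> int" where
  "w_deg w_plus = 2"
| "w_deg w_minus = -2"

fun w_mult :: "wgen \<times> wgen \<Rightarrow> (wgen \<Rightarrow>\<^sub>0 int)" where
  "w_mult (w_minus, w_minus) = frag_of w_minus"
| "w_mult (w_plus, w_minus) = frag_of w_plus"
| "w_mult (w_minus, w_plus) = frag_of w_plus"
| "w_mult (w_plus, w_plus) = 0"

fun w_comult :: "wgen \<Rightarrow> (wgen \<times> wgen \<Rightarrow>\<^sub>0 int)" where
  "w_comult w_minus = frag_of (w_plus, w_minus) + frag_of (w_minus, w_plus)"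
| "w_comult w_plus = frag_of (w_plus, w_plus)"

definition W :: "wgen graded_alg" where
  "W = \<lparr>gdeg = w_deg, gmult = w_mult, gcomult = w_comult\<rparr>"

definition W_state :: "link_diagram \<Rightarrow> state \<Rightarrow> wgen tensor graded_group" where
  "W_state D s = shift (tensor_power W (circles D s)) (int (num_a D s) - int (num_b s))"

definition parity_states :: "link_diagram \<Rightarrow> nat \<Rightarrow> state set" where
  "parity_states D i = {s \<in> states D. (num_b s + size_sA D) mod 2 = i}"

definition bracket2 :: "link_diagram \<Rightarrow> (state \<Rightarrow> wgen tensor) two_complex" where
  "bracket2 D =
     \<lparr>part0 = graded_sum (parity_states D 0) (W_state D),
      part1 = graded_sum (parity_states D 1) (W_state D),
      bdry0 = (\<lambda>j. cube_map W D (parity_states D 1)),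
      bdry1 = (\<lambda>j. cube_map W D (parity_states D 0))\<rparr>"

definition C2 :: "link_diagram \<Rightarrow> (state \<Rightarrow> wgen tensor) two_complex" where
  "C2 D = shift2 (reflex_pow (bracket2 D) (writhe D)) (-3 * writhe D)"

definition H2 :: "link_diagram \<Rightarrow> nat \<Rightarrow> int \<Rightarrow> (state \<Rightarrow> wgen tensor) set monoid" where
  "H2 D i j = homology2 (C2 D) i j"


section \<open>Khovanov homology\<close>

datatype vgen = v_plus | v_minus

fun v_deg :: "vgen \<Rightarrow> int" where
  "v_deg v_plus = 1"
| "v_deg v_minus = -1"

fun v_mult :: "vgen \<times> vgen \<Rightarrow> (vgen \<Rightarrow>\<^sub>0 int)" where
  "v_mult (v_plus, v_plus) = frag_of v_plus"
| "v_mult (v_plus, v_minus) = frag_of v_minus"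
| "v_mult (v_minus, v_plus) = frag_of v_minus"
| "v_mult (v_minus, v_minus) = 0"

fun v_comult :: "vgen \<Rightarrow> (vgen \<times> vgen \<Rightarrow>\<^sub>0 int)" where
  "v_comult v_plus = frag_of (v_plus, v_minus) + frag_of (v_minus, v_plus)"
| "v_comult v_minus = frag_of (v_minus, v_minus)"

definition V :: "vgen graded_alg" where
  "V = \<lparr>gdeg = v_deg, gmult = v_mult, gcomult = v_comult\<rparr>"

definition V_state :: "link_diagram \<Rightarrow> state \<Rightarrow> vgen tensor graded_group" where
  "V_state D s = shift (tensor_power V (circles D s)) (int (num_b s))"

definition level_states :: "link_diagram \<Rightarrow> int \<Rightarrow> state set" where
  "level_states D k = {s \<in> states D. int (num_b s) = k}"

definition Kh_chain :: "link_diagram \<Rightarrow> int \<Rightarrow> (state \<Rightarrow> vgen tensor) graded_group" where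
  "Kh_chain D k = graded_sum (level_states D k) (V_state D)"

definition Kh_diff :: "link_diagram \<Rightarrow> int \<Rightarrow> (state \<Rightarrow> vgen tensor) \<Rightarrow> (state \<Rightarrow> vgen tensor)" where
  "Kh_diff D k = cube_map V D (level_states D (k + 1))"

definition Kh_cohomology :: "link_diagram \<Rightarrow> int \<Rightarrow> (state \<Rightarrow> vgen tensor) set graded_group" where
  "Kh_cohomology D k = (\<lambda>q.
     homology_at (Kh_chain D (k - 1) q) (Kh_diff D (k - 1))
                 (Kh_chain D k q) (Kh_diff D k) (Kh_chain D (k + 1) q))"

definition Kh :: "link_diagram \<Rightarrow> int \<Rightarrow> int \<Rightarrow> (state \<Rightarrow> vgen tensor) set monoid" where
  "Kh D k l = Kh_cohomology D (k + int (n_minus D)) (l - int (n_plus D) + 2 * int (n_minus D))"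

end

(*
  The bijection w_+ <-> v_-, w_- <-> v_+ identifies W with V, with degrees in W -2 times those in V, so it
  identifies each degree of the 2-complex of D with one quantum degree of the Khovanov complex, folded
  modulo 2; the homology of a folded complex is a direct sum over the homological degrees of one parity.

  The vanishing statements are parity counts. In a checkerboard coloured diagram every splitting
  exchanges the colours of the darts, so the circles of a state are the cycles of a permutation of
  the darts of one colour, and changing one marker composes this permutation with a transposition:
  the parity of the number of circles changes with each marker. Comparing, in the same way, the
  Seifert state with the permutation that follows the strands of the link gives
  N = n_+ + |s_A| modulo 2.
*)

theory Submission
  imports Defs "HOL-Combinatorics.Transposition"
begin

section \<open>Orbits of permutations and transpositions\<close>

text \<open>A planar diagram code carries no colouring. The checkerboard colouring has to be
  extracted from the Euler characteristic equation that encodes planarity, and this is the only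
  place where that equation enters. It serves both halves of the proof. Besides the parity counts,
  the comparison of the cubes depends on it: after a merge \<open>edge_map\<close> fills in a single
  new circle, so it must be known that joining two circles leaves only one at the crossing.

  Folding by itself yields the parity of k - (i + n_+ + |s_A|), not a condition on j modulo 4. The
  two descriptions are linked through the degrees. A generator of V has degree 1 or -1, so the
  quantum degree has a fixed parity on all chain groups, and the chain groups in degree j vanish
  unless j/2 and n_+ + |s_A| have the same parity. Where they agree, the two conditions on k are the
  same; where they differ, the groups vanish for both values of i, so both conditions on k are
  correct.\<close>

definition permutes_all :: "('a \<Rightarrow> 'a) set \<Rightarrow> 'a set \<Rightarrow> bool" where
  "permutes_all F X \<longleftrightarrow> finite X \<and> (\<forall>f\<in>F. bij_betw f X X)"

lemma orb_refl [simp, intro]: "x \<in> orb F X x"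
  by (simp add: orb_def)

lemma orb_step:
  assumes "y \<in> orb F X x" "y \<in> X" "f \<in> F"
  shows "f y \<in> orb F X x"
proof -
  have "(y, f y) \<in> {(z, f z) | z f. z \<in> X \<and> f \<in> F}"
    using assms by blast
  then show ?thesis
    using assms(1) unfolding orb_def by (auto intro: rtrancl.rtrancl_into_rtrancl)
qed

lemma orb_trans: "y \<in> orb F X x \<Longrightarrow> z \<in> orb F X y \<Longrightarrow> z \<in> orb F X x"
  by (auto simp: orb_def)

lemma orb_induct [consumes 1, case_names refl step]:
  assumes "y \<in> orb F X x" "P x"
    and "\<And>y f. y \<in> orb F X x \<Longrightarrow> y \<in> X \<Longrightarrow> f \<in> F \<Longrightarrow> P y \<Longrightarrow> P (f y)"
  shows "P y"
proof -
  have "(x, y) \<in> {(z, f z) | z f. z \<in> X \<and> f \<in> F}\<^sup>*"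
    using assms(1) by (simp add: orb_def)
  then show ?thesis
  proof (induction rule: rtrancl_induct)
    case base
    show ?case by (fact assms(2))
  next
    case (step y z)
    then show ?case
      using assms(3) unfolding orb_def by blast
  qed
qed

lemma orb_subset_closed:
  assumes "x \<in> S" "\<And>y f. y \<in> S \<Longrightarrow> y \<in> X \<Longrightarrow> f \<in> F \<Longrightarrow> f y \<in> S"
  shows "orb F X x \<subseteq> S"
proof
  fix y assume "y \<in> orb F X x"
  then show "y \<in> S"
    by (induction rule: orb_induct) (use assms in auto)
qed

lemma permutes_all_mem: "permutes_all F X \<Longrightarrow> f \<in> F \<Longrightarrow> x \<in> X \<Longrightarrow> f x \<in> X"
  unfolding permutes_all_def by (meson bij_betwE)

lemma orb_subset: "permutes_all F X \<Longrightarrow> x \<in> X \<Longrightarrow> orb F X x \<subseteq> X"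
  by (rule orb_subset_closed) (auto intro: permutes_all_mem)

text \<open>\<open>orb\<close> uses forward steps only. On a finite set an injective map that sends
  the orbit of \<open>f y\<close> into itself sends it onto itself, so \<open>y\<close> is reached
  again from \<open>f y\<close>. Hence orbits partition \<open>X\<close>.\<close>

lemma orb_sym:
  assumes F: "permutes_all F X" and x: "x \<in> X" and y: "y \<in> orb F X x"
  shows "x \<in> orb F X y"
  using y
proof (induction rule: orb_induct)
  case refl
  show ?case by simp
next
  case (step y f)
  let ?O = "orb F X (f y)"
  have "f y \<in> X"
    using step F by (auto intro: permutes_all_mem)
  then have sub: "?O \<subseteq> X"
    by (rule orb_subset[OF F])
  have inj: "inj_on f X" and fin: "finite X"
    using F step by (auto simp: permutes_all_def bij_betw_def)
  have "f ` ?O \<subseteq> ?O"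
    using sub step by (auto intro: orb_step)
  then have "f ` ?O = ?O"
    using endo_inj_surj[of ?O f] finite_subset[OF sub fin] inj_on_subset[OF inj sub] by blast
  then obtain w where "w \<in> ?O" "f y = f w"
    using orb_refl[of "f y" F X] by blast
  then have "y \<in> ?O"
    using inj sub step by (metis inj_onD subsetD)
  then show ?case
    using step orb_trans by metis
qed

lemma orb_eq_iff:
  assumes "permutes_all F X" "x \<in> X"
  shows "orb F X x = orb F X y \<longleftrightarrow> y \<in> orb F X x"
proof
  assume y: "y \<in> orb F X x"
  then have "x \<in> orb F X y"
    by (rule orb_sym[OF assms])
  with y show "orb F X x = orb F X y"
    by (auto intro: orb_trans)
qed (metis orb_refl)

lemma orb_mono:
  assumes "\<And>f x. f \<in> F \<Longrightarrow> x \<in> X \<Longrightarrow> f x \<in> orb G X x"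
  shows "orb F X x \<subseteq> orb G X x"
  by (rule orb_subset_closed) (use assms in \<open>auto intro: orb_trans\<close>)

lemma card_image_coarser:
  assumes "finite X" "\<And>x y. x \<in> X \<Longrightarrow> y \<in> X \<Longrightarrow> g x = g y \<Longrightarrow> h x = h y"
  shows "card (h ` X) \<le> card (g ` X)"
proof -
  have "h x = h (inv_into X g (g x))" if "x \<in> X" for x
    using that assms(2)[of x "inv_into X g (g x)"]
    by (simp add: f_inv_into_f inv_into_into)
  then have "h ` X = (\<lambda>y. h (inv_into X g y)) ` (g ` X)"
    by (auto simp: image_image)
  then show ?thesis
    using assms(1) by (metis card_image_le finite_imageI)
qed

lemma card_orbs_antimono:
  assumes "permutes_all F X" "permutes_all G X"
    and "\<And>f x. f \<in> F \<Longrightarrow> x \<in> X \<Longrightarrow> f x \<in> orb G X x"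
  shows "card (orbs G X) \<le> card (orbs F X)"
  unfolding orbs_def
proof (rule card_image_coarser)
  fix x y
  assume "x \<in> X" "y \<in> X" "orb F X x = orb F X y"
  then have "y \<in> orb F X x"
    by simp
  then have "y \<in> orb G X x"
    using orb_mono[of F X G x] assms(3) by blast
  then show "orb G X x = orb G X y"
    using orb_eq_iff[OF assms(2) \<open>x \<in> X\<close>] by blast
qed (use assms in \<open>simp add: permutes_all_def\<close>)

text \<open>Orbits are told apart by labels that are constant under \<open>F\<close>. In the double
  cover such labels separate the two lifts of a vertex or of a face.\<close>

lemma card_orbs_ge_invariant:
  assumes "permutes_all F X" "\<And>f x. f \<in> F \<Longrightarrow> x \<in> X \<Longrightarrow> h (f x) = h x"
  shows "card (h ` X) \<le> card (orbs F X)"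
  unfolding orbs_def
proof (rule card_image_coarser)
  fix x y
  assume "x \<in> X" "y \<in> X" "orb F X x = orb F X y"
  then have "y \<in> orb F X x"
    by simp
  then show "h x = h y"
    by (induction rule: orb_induct) (use assms in auto)
qed (use assms in \<open>simp add: permutes_all_def\<close>)

section \<open>Effect of a transposition on the number of orbits\<close>

lemma bij_betw_transpose: "a \<in> X \<Longrightarrow> b \<in> X \<Longrightarrow> bij_betw (transpose a b) X X"
  by (rule bij_betw_byWitness[where f' = "transpose a b"]) (auto simp: transpose_def)

lemma permutes_all_insert_transpose:
  "permutes_all F X \<Longrightarrow> a \<in> X \<Longrightarrow> b \<in> X \<Longrightarrow> permutes_all (insert (transpose a b) F) X"
  by (simp add: permutes_all_def bij_betw_transpose)

lemma permutes_all_comp_transpose: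
  "permutes_all {p} X \<Longrightarrow> a \<in> X \<Longrightarrow> b \<in> X \<Longrightarrow> permutes_all {p \<circ> transpose a b} X"
  by (auto simp: permutes_all_def intro: bij_betw_trans bij_betw_transpose)

text \<open>The transposition acts like an additional edge between \<open>a\<close> and
  \<open>b\<close>: the union of their orbits is closed under all generators, and no other orbit
  meets the edge.\<close>

lemma orb_insert_transpose:
  assumes F: "permutes_all F X" and ab: "a \<in> X" "b \<in> X" and x: "x \<in> X"
  shows "orb (insert (transpose a b) F) X x =
    (if x \<in> orb F X a \<union> orb F X b then orb F X a \<union> orb F X b else orb F X x)"
    (is "orb ?G X x = _")
proof -
  have G: "permutes_all ?G X"
    by (rule permutes_all_insert_transpose[OF F ab])
  have FG: "orb F X y \<subseteq> orb ?G X y" for y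
    by (rule orb_mono) (auto intro: orb_step)
  have "b \<in> orb ?G X a"
    using orb_step[OF orb_refl[of a], of X "transpose a b" ?G] ab by simp
  then have eq: "orb ?G X a = orb ?G X b"
    using orb_eq_iff[OF G ab(1)] by simp
  let ?U = "orb F X a \<union> orb F X b"
  have step: "f y \<in> ?U" if "y \<in> ?U" "y \<in> X" "f \<in> ?G" for y f
    using that by (auto simp: transpose_def intro: orb_step split: if_splits)
  show ?thesis
  proof (cases "x \<in> ?U")
    case True
    have "orb ?G X x \<subseteq> ?U"
      using True by (rule orb_subset_closed) (rule step)
    moreover have "orb ?G X x = orb ?G X a"
      using True FG[of a] FG[of b] eq orb_eq_iff[OF G ab(1)] orb_eq_iff[OF G ab(2)] by blast
    ultimately have "orb ?G X x = ?U"
      using FG[of a] FG[of b] eq by blast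
    with True show ?thesis by simp
  next
    case False
    have "a \<notin> orb F X x" "b \<notin> orb F X x"
      using False orb_sym[OF F x] by auto
    then have "orb ?G X x \<subseteq> orb F X x"
      by (intro orb_subset_closed) (auto simp: transpose_def intro: orb_step)
    with FG[of x] False show ?thesis by auto
  qed
qed

lemma card_orbs_insert_transpose:
  assumes F: "permutes_all F X" and ab: "a \<in> X" "b \<in> X"
  shows "card (orbs F X) =
    card (orbs (insert (transpose a b) F) X) + (if b \<in> orb F X a then 0 else 1)"
proof -
  let ?G = "insert (transpose a b) F"
  let ?A = "orb F X a" and ?B = "orb F X b"
  define R where "R = orb F X ` (X - (?A \<union> ?B))"
  have fin: "finite R"
    using F by (simp add: R_def permutes_all_def)
  have eqA: "orb F X x = ?A" if "x \<in> ?A" for x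
    using that orb_eq_iff[OF F ab(1)] by blast
  have eqB: "orb F X x = ?B" if "x \<in> ?B" for x
    using that orb_eq_iff[OF F ab(2)] by blast
  have "X = (X - (?A \<union> ?B)) \<union> (X \<inter> (?A \<union> ?B))" by blast
  then have "orb F X ` X = R \<union> orb F X ` (X \<inter> (?A \<union> ?B))"
    unfolding R_def by (metis image_Un)
  moreover have "orb F X ` (X \<inter> (?A \<union> ?B)) = {?A, ?B}"
  proof (intro subset_antisym subsetI)
    fix O' assume "O' \<in> orb F X ` (X \<inter> (?A \<union> ?B))"
    then show "O' \<in> {?A, ?B}" using eqA eqB by blast
  next
    fix O' assume "O' \<in> {?A, ?B}"
    then show "O' \<in> orb F X ` (X \<inter> (?A \<union> ?B))" using ab by blast
  qed
  ultimately have 1: "orbs F X = insert ?A (insert ?B R)"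
    by (auto simp: orbs_def)
  have "orb ?G X ` X = (\<lambda>x. if x \<in> ?A \<union> ?B then ?A \<union> ?B else orb F X x) ` X"
    by (rule image_cong) (simp_all only: orb_insert_transpose[OF F ab])
  also have "\<dots> = insert (?A \<union> ?B) R"
    using ab unfolding R_def by auto
  finally have 2: "orbs ?G X = insert (?A \<union> ?B) R"
    by (simp add: orbs_def)
  have notin: "?A \<notin> R" "?B \<notin> R" "?A \<union> ?B \<notin> R"
    using orb_refl unfolding R_def by (fastforce simp: orb_eq_iff[OF F])+
  have "?A = ?B \<longleftrightarrow> b \<in> ?A"
    by (rule orb_eq_iff[OF F ab(1)])
  with 1 2 fin notin show ?thesis by auto
qed

lemma orb_singleton_funpow:
  "y \<in> orb {p} X x \<Longrightarrow> \<exists>i. y = (p ^^ i) x"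
proof (induction rule: orb_induct)
  case refl
  show ?case by (rule exI[of _ 0]) simp
next
  case (step y f)
  then show ?case
    by (metis comp_apply funpow.simps(2) singletonD)
qed

text \<open>The new map sends \<open>a\<close> to \<open>p b\<close>, so its cycle through
  \<open>a\<close> enters the \<open>p\<close>-cycle of \<open>b\<close> and follows it up to
  \<open>b\<close>; it cannot leave earlier because \<open>a\<close> is not on that cycle.
  Consequently the composed map has the same orbits as \<open>p\<close> together with the
  transposition, and these are already counted.\<close>

lemma orb_comp_transpose_merge:
  assumes p: "permutes_all {p} X" and ab: "a \<in> X" "b \<in> X" and notin: "b \<notin> orb {p} X a"
  shows "b \<in> orb {p \<circ> transpose a b} X a"
    and "card (orbs {p} X) = card (orbs {p \<circ> transpose a b} X) + 1"
proof -
  define q where "q = p \<circ> transpose a b"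
  have Pq: "permutes_all {q} X"
    unfolding q_def by (rule permutes_all_comp_transpose[OF p ab])
  have ne: "a \<noteq> b" using notin by auto
  have pX: "p x \<in> X" if "x \<in> X" for x
    using permutes_all_mem[OF p _ that] by simp
  have qa: "q a = p b" and qb: "q b = p a" by (auto simp: q_def)
  have q_eq: "q y = p y" if "y \<noteq> a" "y \<noteq> b" for y
    using that by (simp add: q_def)
  have step: "q y \<in> orb {q} X x" if "y \<in> orb {q} X x" "y \<in> X" for x y
    using orb_step[OF that] by blast
  have a_notin: "a \<notin> orb {p} X b"
    using notin orb_sym[OF p ab(2)] by blast
  have "b \<in> orb {p} X (p b)"
    using orb_sym[OF p ab(2) orb_step[OF orb_refl ab(2)]] by blast
  moreover have "y \<in> orb {q} X a" if "y \<in> orb {p} X (p b)" for y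
    using that
  proof (induction rule: orb_induct)
    case refl
    show ?case using step[OF orb_refl ab(1)] qa by simp
  next
    case (step y f)
    have "y \<in> orb {p} X b"
      using step orb_trans[OF orb_step[OF orb_refl ab(2)]] by blast
    then have "y \<noteq> a" using a_notin by blast
    show ?case
    proof (cases "y = b")
      \<comment> \<open>The \<open>p\<close>-cycle has closed up: the next point is
        \<open>p b\<close>, which is \<open>q a\<close>.\<close>
      case True
      then show ?thesis
        using step orb_step[OF orb_refl ab(1), of q "{q}"] qa by auto
    next
      case False
      then have "f y = q y"
        using step \<open>y \<noteq> a\<close> by (simp add: q_eq)
      then show ?thesis
        using step orb_step[of y "{q}" X a q] by simp
    qed
  qed
  ultimately have b: "b \<in> orb {q} X a" by blast
  then show "b \<in> orb {p \<circ> transpose a b} X a" by (simp only: q_def)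
  have eq: "orb {q} X b = orb {q} X a"
    using b orb_eq_iff[OF Pq ab(1)] by blast
  let ?G = "insert (transpose a b) {p}"
  have G: "permutes_all ?G X"
    by (rule permutes_all_insert_transpose[OF p ab])
  have "card (orbs ?G X) \<le> card (orbs {q} X)"
  proof (rule card_orbs_antimono[OF Pq G])
    fix f x assume "f \<in> {q}" "x \<in> X"
    moreover have "transpose a b x \<in> X"
      using \<open>x \<in> X\<close> ab by (auto simp: transpose_def)
    ultimately show "f x \<in> orb ?G X x"
      using orb_step[OF orb_step[OF orb_refl, of x X "transpose a b" ?G], of p] by (simp add: q_def)
  qed
  moreover have "card (orbs {q} X) \<le> card (orbs ?G X)"
  proof (rule card_orbs_antimono[OF G Pq])
    fix f x assume f: "f \<in> ?G" and x: "x \<in> X"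
    consider "f = transpose a b" | "f = p" using f by auto
    then show "f x \<in> orb {q} X x"
    proof cases
      case 1
      then show ?thesis
        using b eq orb_refl[of b "{q}" X] orb_refl[of a "{q}" X] by (auto simp: transpose_def)
    next
      case 2
      consider "x = a" | "x = b" | "x \<noteq> a" "x \<noteq> b" by blast
      then show ?thesis
      proof cases
        case 1
        then show ?thesis using step[OF b ab(2)] qb \<open>f = p\<close> by simp
      next
        case 2
        then show ?thesis using step[OF orb_refl ab(1)] qa \<open>f = p\<close> eq by simp
      next
        case 3
        then show ?thesis using step[OF orb_refl x] \<open>f = p\<close> by (simp add: q_eq)
      qed
    qed
  qed
  ultimately show "card (orbs {p} X) = card (orbs {p \<circ> transpose a b} X) + 1"
    unfolding q_def[symmetric] using card_orbs_insert_transpose[OF p ab] notin by simp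
qed

text \<open>The stretch of the \<open>p\<close>-cycle from \<open>p a\<close> to the first
  occurrence of \<open>b\<close> is closed under the composed map, which sends \<open>b\<close> back
  to \<open>p a\<close>. It misses \<open>a\<close>, so \<open>a\<close> and \<open>b\<close> are
  separated. Composing with the same transposition again gives back \<open>p\<close>, and the
  merging case applies in reverse.\<close>

lemma orb_comp_transpose_split:
  assumes p: "permutes_all {p} X" and ab: "a \<in> X" "b \<in> X" "a \<noteq> b" and mem: "b \<in> orb {p} X a"
  shows "card (orbs {p \<circ> transpose a b} X) = card (orbs {p} X) + 1"
proof -
  let ?q = "p \<circ> transpose a b"
  have q: "permutes_all {?q} X"
    using p ab by (auto intro: permutes_all_comp_transpose)
  define n where "n = (LEAST i. b = (p ^^ i) a)"
  have n: "b = (p ^^ n) a"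
    unfolding n_def by (rule LeastI_ex) (rule orb_singleton_funpow[OF mem])
  have least: "b \<noteq> (p ^^ i) a" if "i < n" for i
    using that not_less_Least unfolding n_def by blast
  have npos: "n > 0" using n ab by (cases n) auto
  define S where "S = (\<lambda>i. (p ^^ i) a) ` {1..n}"
  have aS: "a \<notin> S"
  proof
    assume "a \<in> S"
    then obtain i where i: "1 \<le> i" "i \<le> n" "a = (p ^^ i) a"
      by (auto simp: S_def)
    \<comment> \<open>A return to \<open>a\<close> after \<open>i\<close> steps would make the first
      visit to \<open>b\<close> happen \<open>i\<close> steps earlier.\<close>
    have "(p ^^ n) a = (p ^^ (n - i + i)) a"
      using i by simp
    also have "\<dots> = (p ^^ (n - i)) a"
      unfolding funpow_add comp_apply i(3)[symmetric] ..
    finally show False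
      using n least[of "n - i"] i npos by simp
  qed
  have bS: "b \<in> S" using n npos by (auto simp: S_def)
  have pa: "p a \<in> S" using npos by (force simp: S_def image_iff)
  have "orb {?q} X b \<subseteq> S"
  proof (rule orb_subset_closed[OF bS])
    fix y f assume y: "y \<in> S" and f: "f \<in> {?q}"
    have "y \<noteq> a" using y aS by blast
    show "f y \<in> S"
    proof (cases "y = b")
      case True
      then show ?thesis using f pa by simp
    next
      case False
      obtain i where i: "1 \<le> i" "i \<le> n" "y = (p ^^ i) a"
        using y by (auto simp: S_def)
      then have "Suc i \<le> n" using False n by (metis Suc_leI le_neq_implies_less)
      moreover have "f y = (p ^^ Suc i) a"
        using f False \<open>y \<noteq> a\<close> i by (simp add: transpose_def)
      ultimately show ?thesis by (auto simp: S_def simp del: funpow.simps)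
    qed
  qed
  then have "a \<notin> orb {?q} X b" using aS by blast
  then have "b \<notin> orb {?q} X a"
    using orb_sym[OF q ab(1)] by blast
  then have "card (orbs {?q} X) = card (orbs {?q \<circ> transpose a b} X) + 1"
    by (rule orb_comp_transpose_merge(2)[OF q ab(1,2)])
  moreover have "?q \<circ> transpose a b = p"
    by (simp add: comp_assoc)
  ultimately show ?thesis by simp
qed

lemma card_orbs_comp_transpose_parity:
  assumes "permutes_all {p} X" "a \<in> X" "b \<in> X" "a \<noteq> b"
  shows "even (card (orbs {p \<circ> transpose a b} X)) \<longleftrightarrow> odd (card (orbs {p} X))"
proof (cases "b \<in> orb {p} X a")
  case True
  then show ?thesis using orb_comp_transpose_split[OF assms] by simp
next
  case False
  then show ?thesis using orb_comp_transpose_merge(2)[OF assms(1-3)] by simp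
qed

section \<open>Involutions and the genus inequality\<close>

lemma permutes_all_involution:
  assumes "finite X" "\<And>x. x \<in> X \<Longrightarrow> f x \<in> X \<and> f (f x) = x"
  shows "permutes_all {f} X"
  using assms by (auto simp: permutes_all_def intro!: bij_betw_byWitness[where f' = f])

lemma permutes_all_insert:
  "permutes_all (insert f F) X \<longleftrightarrow> permutes_all {f} X \<and> permutes_all F X"
  by (auto simp: permutes_all_def)

lemma permutes_all_comp:
  "permutes_all {f} X \<Longrightarrow> permutes_all {g} X \<Longrightarrow> permutes_all {f \<circ> g} X"
  by (auto simp: permutes_all_def intro: bij_betw_trans)

text \<open>
  For a rotation system \<open>\<alpha>\<close> with edge involution \<open>\<beta>\<close> this says that the genus is nonnegative.
\<close>

lemma genus_nonneg:
  assumes \<alpha>: "permutes_all {\<alpha>} X" and \<beta>: "\<And>x. x \<in> X \<Longrightarrow> \<beta> x \<in> X \<and> \<beta> (\<beta> x) = x"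
  shows "2 * (card (orbs {\<alpha>} X) + card (orbs {\<alpha> \<circ> \<beta>} X))
    \<le> card {x \<in> X. \<beta> x \<noteq> x} + 4 * card (orbs {\<alpha>, \<beta>} X)"
  using \<beta>
\<comment> \<open>Each induction step deletes one edge, whose two ends become fixed points of the
  involution. The number of moved points is twice the number of edges.\<close>
proof (induction "card {x \<in> X. \<beta> x \<noteq> x}" arbitrary: \<beta> rule: less_induct)
  case less
  have fin: "finite X" using \<alpha> by (simp add: permutes_all_def)
  have P\<beta>: "permutes_all {\<beta>} X"
    by (rule permutes_all_involution[OF fin less.prems])
  have P\<alpha>\<beta>: "permutes_all {\<alpha> \<circ> \<beta>} X"
    by (rule permutes_all_comp[OF \<alpha> P\<beta>])
  have P2: "permutes_all {\<alpha>, \<beta>} X"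
    using \<alpha> P\<beta> permutes_all_insert by blast
  show ?case
  proof (cases "\<exists>a\<in>X. \<beta> a \<noteq> a")
    \<comment> \<open>Without edges, vertices, faces and pieces coincide.\<close>
    case False
    then have fixed: "\<And>x. x \<in> X \<Longrightarrow> \<beta> x = x" by blast
    have "card (orbs {\<alpha>} X) \<le> card (orbs {\<alpha>, \<beta>} X)"
      by (rule card_orbs_antimono[OF P2 \<alpha>]) (use fixed in \<open>auto intro: orb_step\<close>)
    moreover have "card (orbs {\<alpha> \<circ> \<beta>} X) \<le> card (orbs {\<alpha>} X)"
      by (rule card_orbs_antimono[OF \<alpha> P\<alpha>\<beta>])
        (use fixed orb_step[OF orb_refl, of _ X "\<alpha> \<circ> \<beta>" "{\<alpha> \<circ> \<beta>}"] in auto)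
    ultimately show ?thesis by simp
  next
    case True
    then obtain a where a: "a \<in> X" "\<beta> a \<noteq> a" by blast
    define b where "b = \<beta> a"
    have b: "b \<in> X" "\<beta> b = a" "b \<noteq> a" "\<beta> a = b"
      using less.prems a by (auto simp: b_def)
    define \<gamma> where "\<gamma> = \<beta> \<circ> transpose a b"
    have \<gamma>_eq: "\<gamma> x = (if x = a \<or> x = b then x else \<beta> x)" for x
      using b by (auto simp: \<gamma>_def transpose_def)
    have \<beta>_eq: "\<beta> = \<gamma> \<circ> transpose a b"
      by (simp add: \<gamma>_def comp_assoc)
    have \<gamma>: "\<gamma> x \<in> X \<and> \<gamma> (\<gamma> x) = x" if "x \<in> X" for x
      using less.prems[OF that] that b a less.prems by (metis \<gamma>_eq)
    have P\<gamma>: "permutes_all {\<gamma>} X"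
      by (rule permutes_all_involution[OF fin \<gamma>])
    have moved: "{x \<in> X. \<beta> x \<noteq> x} = insert a (insert b {x \<in> X. \<gamma> x \<noteq> x})"
      using a b by (auto simp: \<gamma>_eq)
    have cm: "card {x \<in> X. \<beta> x \<noteq> x} = card {x \<in> X. \<gamma> x \<noteq> x} + 2"
      unfolding moved using fin b by (simp add: \<gamma>_eq)
    have IH: "2 * (card (orbs {\<alpha>} X) + card (orbs {\<alpha> \<circ> \<gamma>} X))
        \<le> card {x \<in> X. \<gamma> x \<noteq> x} + 4 * card (orbs {\<alpha>, \<gamma>} X)"
      by (rule less.hyps) (use cm \<gamma> in auto)
    let ?p = "\<alpha> \<circ> \<gamma>"
    have p: "permutes_all {?p} X"
      by (rule permutes_all_comp[OF \<alpha> P\<gamma>])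
    have comp: "\<alpha> \<circ> \<beta> = ?p \<circ> transpose a b"
      unfolding \<beta>_eq by (simp add: comp_assoc)
    have F: "permutes_all {\<alpha>, \<gamma>} X"
      using \<alpha> P\<gamma> permutes_all_insert by blast
    let ?G = "insert (transpose a b) {\<alpha>, \<gamma>}"
    have G: "permutes_all ?G X"
      by (rule permutes_all_insert_transpose[OF F a(1) b(1)])
    have le: "card (orbs ?G X) \<le> card (orbs {\<alpha>, \<beta>} X)"
    proof (rule card_orbs_antimono[OF P2 G])
      fix f x assume f: "f \<in> {\<alpha>, \<beta>}" and x: "x \<in> X"
      have t: "transpose a b x \<in> X"
        using x a b by (auto simp: transpose_def)
      have "\<beta> x = \<gamma> (transpose a b x)"
        by (simp add: \<beta>_eq)
      then have "\<beta> x \<in> orb ?G X x"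
        using orb_step[OF orb_step[OF orb_refl x, of "transpose a b" ?G] t, of \<gamma>] by simp
      moreover have "\<alpha> x \<in> orb ?G X x"
        using x by (auto intro: orb_step)
      ultimately show "f x \<in> orb ?G X x" using f by auto
    qed
    \<comment> \<open>Here \<open>a\<close> counts vertices, \<open>c\<close> and \<open>d\<close>
      count faces and pieces without the edge, \<open>c'\<close> and \<open>d'\<close> those with
      it, and \<open>m\<close>, \<open>m'\<close> the moved points.\<close>
    have arith: "2 * (a + c') \<le> m' + 4 * d'"
      if "2 * (a + c) \<le> m + 4 * d" "m' = m + 2" "c' + 2 * d \<le> c + 1 + 2 * d'"
      for a c m d c' m' d' :: nat
      using that by presburger
    show ?thesis
    proof (cases "b \<in> orb {?p} X a")
      \<comment> \<open>Both ends lie on one face: the edge cuts this face in two and joins no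
        pieces.\<close>
      case True
      have "orb {?p} X a \<subseteq> orb {\<alpha>, \<gamma>} X a"
      proof (rule orb_mono)
        fix f x assume "f \<in> {?p}" "x \<in> X"
        then show "f x \<in> orb {\<alpha>, \<gamma>} X x"
          using orb_step[OF orb_step[OF orb_refl, of x X \<gamma> "{\<alpha>, \<gamma>}"], of \<alpha>] \<gamma> by simp
      qed
      with True have "b \<in> orb {\<alpha>, \<gamma>} X a" by blast
      then have "card (orbs {\<alpha>, \<gamma>} X) = card (orbs ?G X)"
        using card_orbs_insert_transpose[OF F a(1) b(1)] by simp
      moreover have "card (orbs {\<alpha> \<circ> \<beta>} X) = card (orbs {?p} X) + 1"
        unfolding comp using orb_comp_transpose_split[OF p a(1) b(1) _ True] b by simp
      ultimately have "card (orbs {\<alpha> \<circ> \<beta>} X) + 2 * card (orbs {\<alpha>, \<gamma>} X)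
          \<le> card (orbs {?p} X) + 1 + 2 * card (orbs {\<alpha>, \<beta>} X)"
        using le by linarith
      then show ?thesis by (rule arith[OF IH cm])
    next
      \<comment> \<open>The edge joins two faces; the lost face compensates for the possible loss of
        one piece.\<close>
      case False
      have "card (orbs {\<alpha>, \<gamma>} X) \<le> card (orbs ?G X) + 1"
        using card_orbs_insert_transpose[OF F a(1) b(1)] by simp
      moreover have "card (orbs {?p} X) = card (orbs {\<alpha> \<circ> \<beta>} X) + 1"
        unfolding comp using orb_comp_transpose_merge(2)[OF p a(1) b(1) False] by simp
      ultimately have "card (orbs {\<alpha> \<circ> \<beta>} X) + 2 * card (orbs {\<alpha>, \<gamma>} X)
          \<le> card (orbs {?p} X) + 1 + 2 * card (orbs {\<alpha>, \<beta>} X)"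
        using le by linarith
      then show ?thesis by (rule arith[OF IH cm])
    qed
  qed
qed

section \<open>Colourings and circles of diagrams\<close>

lemma orbs_cong:
  assumes "\<And>x. x \<in> X \<Longrightarrow> p x = q x"
  shows "orb (insert p F) X = orb (insert q F) X" "orbs (insert p F) X = orbs (insert q F) X"
proof -
  have split: "{(z, f z) | z f. z \<in> X \<and> f \<in> insert r F} =
      {(z, r z) | z. z \<in> X} \<union> {(z, f z) | z f. z \<in> X \<and> f \<in> F}" for r
    by auto
  have "{(z, f z) | z f. z \<in> X \<and> f \<in> insert p F} = {(z, f z) | z f. z \<in> X \<and> f \<in> insert q F}"
    unfolding split using assms by auto
  then show "orb (insert p F) X = orb (insert q F) X"
    by (simp add: orb_def fun_eq_iff)
  then show "orbs (insert p F) X = orbs (insert q F) X"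
    by (simp add: orbs_def)
qed

text \<open>Two colourings fit this pattern. For Kauffman states \<open>g\<close> is a splitting and
  \<open>\<kappa>\<close> a checkerboard colouring; for the passage from strands to Seifert circles
  \<open>g\<close> mixes splittings with \<open>opposite\<close>, and \<open>\<kappa>\<close>
  singles out the outgoing darts. In both cases \<open>f\<close> is the gluing of edges, and an
  orbit is a circle traversed with alternating colours.\<close>

locale alternating_involutions =
  fixes X :: "'a set" and f g :: "'a \<Rightarrow> 'a" and \<kappa> :: "'a \<Rightarrow> bool"
  assumes finite_X: "finite X"
    and f: "\<And>x. x \<in> X \<Longrightarrow> f x \<in> X \<and> f (f x) = x \<and> (\<kappa> (f x) \<longleftrightarrow> \<not> \<kappa> x)"
    and g: "\<And>x. x \<in> X \<Longrightarrow> g x \<in> X \<and> g (g x) = x \<and> (\<kappa> (g x) \<longleftrightarrow> \<not> \<kappa> x)"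
begin

definition half :: "'a set" where
  "half = {x \<in> X. \<kappa> x}"

lemma permutes_all_fg: "permutes_all {f, g} X"
  using permutes_all_involution[OF finite_X] permutes_all_insert f g by metis

lemma permutes_all_half: "permutes_all {f \<circ> g} half"
proof -
  have "bij_betw (f \<circ> g) half half"
    by (rule bij_betw_byWitness[where f' = "g \<circ> f"]) (auto simp: half_def f g)
  then show ?thesis
    using finite_X by (simp add: permutes_all_def half_def)
qed

lemma orb_half_iff:
  assumes x: "x \<in> half" and y: "y \<in> half"
  shows "y \<in> orb {f, g} X x \<longleftrightarrow> y \<in> orb {f \<circ> g} half x"
proof -
  define p where "p = f \<circ> g"
  have xX: "x \<in> X" using x by (simp add: half_def)
  have Pp: "permutes_all {p} half"
    using permutes_all_half by (simp add: p_def)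
  have p_eq: "p z = f (g z)" for z by (simp add: p_def)
  have rotate: "f (g z) \<in> orb {p} half x" if "z \<in> orb {p} half x" "z \<in> half" for z
    using orb_step[OF that, of p] by (simp add: p_eq)
  \<comment> \<open>A point \<open>z\<close> of the other colour is represented by its partner
    \<open>f z\<close>, so the invariant survives steps that leave \<open>half\<close>.\<close>
  have "(\<kappa> z \<longrightarrow> z \<in> orb {p} half x) \<and> (\<not> \<kappa> z \<longrightarrow> f z \<in> orb {p} half x)"
    if "z \<in> orb {f, g} X x" for z
    using that
  proof (induction rule: orb_induct)
    case refl
    show ?case using x by (simp add: half_def)
  next
    case (step z h)
    show ?case
    proof (cases "\<kappa> z")
      case True
      then have "z \<in> half" using step by (simp add: half_def)
      moreover have "z \<in> orb {p} half x" using True step by blast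
      ultimately have "f (g z) \<in> orb {p} half x"
        by (rule rotate[rotated])
      moreover have "f (f z) = z" "\<not> \<kappa> (f z)" "\<not> \<kappa> (g z)"
        using True step f g by auto
      ultimately show ?thesis
        using step True by fastforce
    next
      case False
      have gz: "g z \<in> half" using False step g by (simp add: half_def)
      have "f z \<in> orb {p} half x" using False step by simp
      \<comment> \<open>\<open>g z\<close> is the predecessor of \<open>f z\<close> under
        \<open>f \<circ> g\<close>, so symmetry of orbits supplies the backward step.\<close>
      moreover have "f z \<in> orb {p} half (g z)"
        using orb_step[OF orb_refl gz, of p] g[of z] step by (simp add: p_eq)
      then have "g z \<in> orb {p} half (f z)"
        by (rule orb_sym[OF Pp gz])
      ultimately have "g z \<in> orb {p} half x"
        by (rule orb_trans)
      with False step show ?thesis using f[of z] g[of z] by auto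
    qed
  qed
  then have "y \<in> orb {p} half x" if "y \<in> orb {f, g} X x"
    using that y by (simp add: half_def)
  moreover have "orb {p} half x \<subseteq> orb {f, g} X x"
  proof (rule orb_subset_closed)
    fix z h assume z: "z \<in> orb {f, g} X x" "z \<in> half" "h \<in> {p}"
    then have "g z \<in> orb {f, g} X x" by (auto intro: orb_step simp: half_def)
    then have "f (g z) \<in> orb {f, g} X x"
      using z g by (auto intro: orb_step simp: half_def)
    with z show "h z \<in> orb {f, g} X x" by (simp add: p_eq)
  qed simp
  ultimately show ?thesis
    unfolding p_def by blast
qed

lemma card_orbs_half: "card (orbs {f, g} X) = card (orbs {f \<circ> g} half)"
proof -
  define r where "r x = (if \<kappa> x then x else f x)" for x
  have r: "r x \<in> half" if "x \<in> X" for x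
    using that f by (auto simp: r_def half_def)
  have rX: "r x \<in> X" if "x \<in> X" for x
    using r[OF that] by (simp add: half_def)
  have r_half: "r x = x" if "x \<in> half" for x
    using that by (simp add: r_def half_def)
  have "half \<subseteq> X" by (auto simp: half_def)
  have r_image: "r ` X = half"
  proof
    show "half \<subseteq> r ` X"
      using r_half \<open>half \<subseteq> X\<close> by (metis image_eqI subsetD subsetI)
  qed (use r in blast)
  have "r x \<in> orb {f, g} X x" if "x \<in> X" for x
    using that by (auto simp: r_def intro: orb_step)
  then have orb_r: "orb {f, g} X (r x) = orb {f, g} X x" if "x \<in> X" for x
    using orb_eq_iff[OF permutes_all_fg that] that by blast
  have iff: "orb {f, g} X x = orb {f, g} X y \<longleftrightarrow>
      orb {f \<circ> g} half (r x) = orb {f \<circ> g} half (r y)" if "x \<in> X" "y \<in> X" for x y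
    using that orb_r orb_eq_iff[OF permutes_all_fg rX] orb_eq_iff[OF permutes_all_half r]
      orb_half_iff[OF r r] by metis
  have "card (orb {f, g} X ` X) = card ((\<lambda>x. orb {f \<circ> g} half (r x)) ` X)"
    by (rule antisym; rule card_image_coarser[OF finite_X]) (simp_all add: iff)
  also have "(\<lambda>x. orb {f \<circ> g} half (r x)) ` X = orb {f \<circ> g} half ` half"
    unfolding r_image[symmetric] by (simp add: image_image)
  finally show ?thesis by (simp add: orbs_def)
qed

text \<open>On \<open>half\<close> the change from \<open>g\<close> to \<open>h\<close> is
  composition of the permutation \<open>f \<circ> g\<close> with one transposition, so the results
  on cycles of a single permutation carry over to circles.\<close>

lemma swap:
  assumes h: "alternating_involutions X f h \<kappa>"
    and ab: "a \<in> X" "b \<in> X" "\<kappa> a" "\<kappa> b" "a \<noteq> b"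
    and swap: "\<And>x. x \<in> X \<Longrightarrow> \<kappa> x \<Longrightarrow> h x = g (transpose a b x)"
  shows "even (card (orbs {f, h} X)) \<longleftrightarrow> odd (card (orbs {f, g} X))"
    and "b \<notin> orb {f, g} X a \<Longrightarrow> b \<in> orb {f, h} X a"
proof -
  interpret h: alternating_involutions X f h \<kappa> by (fact h)
  have ab': "a \<in> half" "b \<in> half" using ab by (simp_all add: half_def)
  have eq: "(f \<circ> h) x = (f \<circ> g \<circ> transpose a b) x" if "x \<in> half" for x
    using that swap by (simp add: half_def)
  have orb_h: "orb {f \<circ> h} half = orb {f \<circ> g \<circ> transpose a b} half"
    and orbs_h: "orbs {f \<circ> h} half = orbs {f \<circ> g \<circ> transpose a b} half"
    by (rule orbs_cong, rule eq, assumption)+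
  show "even (card (orbs {f, h} X)) \<longleftrightarrow> odd (card (orbs {f, g} X))"
    using card_orbs_comp_transpose_parity[OF permutes_all_half ab' ab(5)]
    unfolding card_orbs_half h.card_orbs_half orbs_h .
  show "b \<in> orb {f, h} X a" if "b \<notin> orb {f, g} X a"
  proof -
    have "b \<notin> orb {f \<circ> g} half a"
      using that orb_half_iff[OF ab'] by blast
    then have "b \<in> orb {f \<circ> g \<circ> transpose a b} half a"
      by (rule orb_comp_transpose_merge(1)[OF permutes_all_half ab'])
    then show ?thesis
      using h.orb_half_iff[of a b] ab' unfolding orb_h by blast
  qed
qed

end

section \<open>Darts and the maps on them\<close>

lemma finite_darts [simp]: "finite (darts D)"
  by (simp add: darts_def)

lemma less_4_cases:
  fixes p :: nat
  assumes "p < 4"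
  obtains "p = 0" | "p = 1" | "p = 2" | "p = 3"
  using assms by linarith

lemma dart_cases:
  assumes "d \<in> darts D"
  obtains c where "c < crossings D" "d = (c, 0)" | c where "c < crossings D" "d = (c, 1)"
    | c where "c < crossings D" "d = (c, 2)" | c where "c < crossings D" "d = (c, 3)"
proof -
  obtain c p where "c < crossings D" "p < 4" "d = (c, p)"
    using assms by (auto simp: darts_def)
  then show thesis
    using that by (elim less_4_cases) blast+
qed

lemma splitting_dart: "d \<in> darts D \<Longrightarrow> splitting s d \<in> darts D \<and> splitting s (splitting s d) = d"
  by (erule dart_cases) (simp_all add: darts_def)

lemma opposite_dart: "d \<in> darts D \<Longrightarrow> opposite d \<in> darts D \<and> opposite (opposite d) = d"
  by (erule dart_cases) (simp_all add: darts_def)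

lemma outgoing_opposite: "d \<in> darts D \<Longrightarrow> outgoing D (opposite d) \<longleftrightarrow> \<not> outgoing D d"
  by (erule dart_cases) simp_all

lemma permutes_all_rotate: "permutes_all {rotate_dart} (darts D)"
proof -
  have "bij_betw rotate_dart (darts D) (darts D)"
  proof (rule bij_betw_byWitness[where f' = "\<lambda>(c, p). (c, (p + 3) mod 4)"])
    show "\<forall>d\<in>darts D. (\<lambda>(c, p). (c, (p + 3) mod 4)) (rotate_dart d) = d"
      by (rule ballI) (erule dart_cases, simp_all)
    show "\<forall>d\<in>darts D. rotate_dart ((\<lambda>(c, p). (c, (p + 3) mod 4)) d) = d"
      by (rule ballI) (erule dart_cases, simp_all)
  qed (auto simp: darts_def)
  then show ?thesis by (simp add: permutes_all_def)
qed

lemma oriented_glue: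
  assumes "oriented_link_diagram D" "d \<in> darts D"
  shows "glue D d \<in> darts D" "glue D (glue D d) = d" "outgoing D (glue D d) \<longleftrightarrow> \<not> outgoing D d"
proof -
  have "\<forall>d\<in>darts D. glue D d \<in> darts D \<and> glue D (glue D d) = d \<and>
      (outgoing D (glue D d) \<longleftrightarrow> \<not> outgoing D d)"
    using assms(1) unfolding oriented_link_diagram_def by (rule conjunct1)
  from bspec[OF this assms(2)]
  show "glue D d \<in> darts D" "glue D (glue D d) = d" "outgoing D (glue D d) \<longleftrightarrow> \<not> outgoing D d"
    by simp_all
qed

section \<open>Checkerboard colourings from planarity\<close>

definition checkerboard :: "link_diagram \<Rightarrow> (dart \<Rightarrow> bool) \<Rightarrow> bool" where
  "checkerboard D \<kappa> \<longleftrightarrow>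
    (\<forall>d\<in>darts D. (\<kappa> (rotate_dart d) \<longleftrightarrow> \<not> \<kappa> d) \<and> (\<kappa> (glue D d) \<longleftrightarrow> \<not> \<kappa> d))"

text \<open>
  If a piece has no colouring, then its double cover in which both maps change the sheet is connected.
  Vertices and faces lift to two copies each, so the cover would have Euler characteristic 4.
\<close>

lemma checkerboard_exists:
  assumes D: "oriented_link_diagram D"
  obtains \<kappa> where "checkerboard D \<kappa>"
proof -
  let ?F = "{rotate_dart, glue D}"
  \<comment> \<open>The second component is the sheet of the double cover; both lifted maps change
    it.\<close>
  define X where "X = darts D \<times> (UNIV :: bool set)"
  define \<alpha> where "\<alpha> = map_prod rotate_dart Not"
  define \<beta> where "\<beta> = map_prod (glue D) Not"
  have finX: "finite X" by (simp add: X_def)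
  have Pg: "permutes_all {glue D} (darts D)"
    by (rule permutes_all_involution) (use oriented_glue[OF D] in auto)
  have PF: "permutes_all ?F (darts D)"
    using Pg permutes_all_rotate permutes_all_insert by blast
  have Pface: "permutes_all {rotate_dart \<circ> glue D} (darts D)"
    by (rule permutes_all_comp[OF permutes_all_rotate Pg])
  have \<beta>: "\<beta> x \<in> X \<and> \<beta> (\<beta> x) = x" if "x \<in> X" for x
    using that oriented_glue[OF D] by (auto simp: X_def \<beta>_def)
  have "bij_betw Not UNIV UNIV"
    by (rule bij_betw_byWitness[where f' = Not]) auto
  then have P\<alpha>: "permutes_all {\<alpha>} X"
    using permutes_all_rotate[of D] finX
    by (auto simp: permutes_all_def \<alpha>_def X_def intro: bij_betw_map_prod)
  have P\<beta>: "permutes_all {\<beta>} X"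
    by (rule permutes_all_involution[OF finX \<beta>])
  have P: "permutes_all {\<alpha>, \<beta>} X"
    using P\<alpha> P\<beta> permutes_all_insert by blast
  let ?P = "card (pieces D)" and ?n = "crossings D"
  have vertices: "2 * ?n \<le> card (orbs {\<alpha>} X)"
  proof -
    \<comment> \<open>A rotation changes both the sheet and the parity of the position, so comparing
      the two gives an invariant that labels the two lifts of a crossing.\<close>
    define h :: "dart \<times> bool \<Rightarrow> nat \<times> bool" where "h = (\<lambda>((c, p), e). (c, e = even p))"
    have "h (f x) = h x" if "f \<in> {\<alpha>}" "x \<in> X" for f x
      using that by (auto simp: h_def \<alpha>_def X_def darts_def elim!: less_4_cases)
    then have "card (h ` X) \<le> card (orbs {\<alpha>} X)"
      by (rule card_orbs_ge_invariant[OF P\<alpha>])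
    moreover have "{..<?n} \<times> UNIV \<subseteq> h ` X"
    proof
      fix y assume "y \<in> {..<?n} \<times> (UNIV :: bool set)"
      then have "y = h ((fst y, 0), snd y)" "((fst y, 0), snd y) \<in> X"
        by (auto simp: h_def X_def darts_def)
      then show "y \<in> h ` X" by blast
    qed
    then have "card ({..<?n} \<times> (UNIV :: bool set)) \<le> card (h ` X)"
      using finX by (intro card_mono) auto
    ultimately show ?thesis by (simp add: card_cartesian_product)
  qed
  have faces: "2 * card (faces D) \<le> card (orbs {\<alpha> \<circ> \<beta>} X)"
  proof -
    \<comment> \<open>A face step changes the sheet twice, so the sheet is constant along each lift
      of a face.\<close>
    define h :: "dart \<times> bool \<Rightarrow> dart set \<times> bool"
      where "h = (\<lambda>(d, e). (orb {rotate_dart \<circ> glue D} (darts D) d, e))"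
    have "h (f x) = h x" if asm: "f \<in> {\<alpha> \<circ> \<beta>}" "x \<in> X" for f x
    proof -
      obtain d e where x: "x = (d, e)" "d \<in> darts D"
        using asm by (auto simp: X_def)
      have "orb {rotate_dart \<circ> glue D} (darts D) ((rotate_dart \<circ> glue D) d)
          = orb {rotate_dart \<circ> glue D} (darts D) d"
        using orb_eq_iff[OF Pface x(2)] orb_step[OF orb_refl x(2)] by blast
      with asm x show ?thesis by (simp add: h_def \<alpha>_def \<beta>_def)
    qed
    then have "card (h ` X) \<le> card (orbs {\<alpha> \<circ> \<beta>} X)"
      by (rule card_orbs_ge_invariant[OF permutes_all_comp[OF P\<alpha> P\<beta>]])
    moreover have "h ` X = faces D \<times> UNIV"
      by (auto simp: h_def X_def faces_def orbs_def image_iff)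
    ultimately show ?thesis by (simp add: card_cartesian_product)
  qed
  have "{x \<in> X. \<beta> x \<noteq> x} = X"
    by (auto simp: X_def \<beta>_def)
  then have edges: "card {x \<in> X. \<beta> x \<noteq> x} = 8 * ?n"
    by (simp add: X_def card_cartesian_product darts_def)
  have "card (faces D) = ?n + 2 * ?P"
    using D by (simp add: oriented_link_diagram_def)
  \<comment> \<open>With n crossings, P pieces and P' pieces of the cover this reads 2 (2 n + 2 (n +
    2 P)) \<le> 8 n + 4 P', that is, 2 P \<le> P'.\<close>
  with genus_nonneg[OF P\<alpha> \<beta>] vertices faces edges
  have pieces: "2 * ?P \<le> card (orbs {\<alpha>, \<beta>} X)"
    by simp
  let ?O = "orb ?F (darts D)" and ?O' = "orb {\<alpha>, \<beta>} X"
  have lift: "\<exists>e'. (z, e') \<in> ?O' (d, e)" if "z \<in> ?O d" for z d e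
    using that
  proof (induction rule: orb_induct)
    case refl
    show ?case by auto
  next
    case (step y f)
    then obtain e' where e': "(y, e') \<in> ?O' (d, e)" by blast
    have "(y, e') \<in> X" using step by (simp add: X_def)
    then have "\<alpha> (y, e') \<in> ?O' (d, e)" "\<beta> (y, e') \<in> ?O' (d, e)"
      using e' by (auto intro: orb_step)
    then show ?case using step by (auto simp: \<alpha>_def \<beta>_def)
  qed
  have separated: "(d0, False) \<notin> ?O' (d0, True)" if d0: "d0 \<in> darts D" for d0
  proof
    assume loop: "(d0, False) \<in> ?O' (d0, True)"
    \<comment> \<open>One representative for each piece, with \<open>d0\<close> chosen for its own
      piece.\<close>
    define r where "r S = (if d0 \<in> S then d0 else (SOME z. z \<in> S))" for S
    define T where "T = r ` pieces D"
    have r: "r (?O d) \<in> ?O d" for d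
      unfolding r_def using someI[of "\<lambda>z. z \<in> ?O d" d] by auto
    have fin: "finite (pieces D)" by (simp add: pieces_def orbs_def)
    have T: "card T \<le> ?P" "finite T"
      using fin by (simp_all add: T_def card_image_le)
    have "d0 = r (?O d0)" by (simp add: r_def)
    then have "d0 \<in> T"
      using d0 unfolding T_def pieces_def orbs_def by blast
    have d0X: "(d0, True) \<in> X" using d0 by (simp add: X_def)
    have eq: "?O' (d0, True) = ?O' (d0, False)"
      using orb_eq_iff[OF P d0X] loop by blast
    let ?Y = "T \<times> (UNIV :: bool set) - {(d0, True)}"
    have "orbs {\<alpha>, \<beta>} X \<subseteq> ?O' ` ?Y"
    proof
      fix S assume "S \<in> orbs {\<alpha>, \<beta>} X"
      then obtain d e where S: "S = ?O' (d, e)" "(d, e) \<in> X"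
        by (auto simp: orbs_def)
      then have d: "d \<in> darts D" by (simp add: X_def)
      obtain e' where "(r (?O d), e') \<in> ?O' (d, e)"
        using lift[OF r] by blast
      then have S': "S = ?O' (r (?O d), e')"
        using orb_eq_iff[OF P S(2)] S(1) by blast
      have "r (?O d) \<in> T"
        using d unfolding T_def pieces_def orbs_def by blast
      show "S \<in> ?O' ` ?Y"
      proof (cases "(r (?O d), e') = (d0, True)")
        case True
        then have "S = ?O' (d0, False)" using S' eq by simp
        with \<open>d0 \<in> T\<close> show ?thesis by blast
      next
        case False
        with S' \<open>r (?O d) \<in> T\<close> show ?thesis by blast
      qed
    qed
    then have "card (orbs {\<alpha>, \<beta>} X) \<le> card ?Y"
      using T by (meson card_image_le card_mono finite_Diff finite_SigmaI finite_UNIV finite_imageI le_trans)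
    also have "\<dots> < card (T \<times> (UNIV :: bool set))"
      using T \<open>d0 \<in> T\<close> by (intro card_Diff1_less) auto
    also have "\<dots> \<le> 2 * ?P"
      using T by (simp add: card_cartesian_product)
    finally show False using pieces by simp
  qed
  define r where "r S = (SOME z. z \<in> S)" for S :: "dart set"
  have r: "r (?O d) \<in> ?O d" for d
    unfolding r_def using someI[of "\<lambda>z. z \<in> ?O d" d] by auto
  \<comment> \<open>The colour of \<open>d\<close> records the sheet on which \<open>d\<close> is
    reached from sheet \<open>True\<close> over the representative of its piece.\<close>
  define \<kappa> where "\<kappa> d \<longleftrightarrow> (d, True) \<in> ?O' (r (?O d), True)" for d
  \<comment> \<open>By \<open>separated\<close> only one lift of \<open>d\<close> lies in that piece
    of the cover, so the sheet does not depend on the path.\<close>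
  have \<kappa>_eq: "\<kappa> d \<longleftrightarrow> e"
    if d: "d \<in> darts D" and e: "(d, e) \<in> ?O' (r (?O d), True)" for d e
  proof (cases e)
    case True
    with e show ?thesis by (simp add: \<kappa>_def)
  next
    case False
    have rX: "(r (?O d), True) \<in> X"
      using r[of d] orb_subset[OF PF d] by (auto simp: X_def)
    have "\<not> \<kappa> d"
    proof
      assume "\<kappa> d"
      then have "?O' (d, True) = ?O' (r (?O d), True)"
        using orb_eq_iff[OF P rX] unfolding \<kappa>_def by blast
      then show False using separated[OF d] e False by simp
    qed
    with False show ?thesis by simp
  qed
  have "\<kappa> (rotate_dart d) \<longleftrightarrow> \<not> \<kappa> d" "\<kappa> (glue D d) \<longleftrightarrow> \<not> \<kappa> d"
    if d: "d \<in> darts D" for d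
  proof -
    have "d \<in> ?O (r (?O d))"
      by (rule orb_sym[OF PF d r])
    then obtain e where e: "(d, e) \<in> ?O' (r (?O d), True)"
      using lift by blast
    have dX: "(d, e) \<in> X" using d by (simp add: X_def)
    have flip: "\<kappa> (f d) \<longleftrightarrow> \<not> \<kappa> d"
      if f: "f \<in> ?F" and lifted: "(f d, \<not> e) \<in> ?O' (r (?O d), True)" for f
    proof -
      have "?O (f d) = ?O d"
        using orb_eq_iff[OF PF d] orb_step[OF orb_refl d f] by blast
      then have "\<kappa> (f d) \<longleftrightarrow> \<not> e"
        using \<kappa>_eq[of "f d"] lifted permutes_all_mem[OF PF f d] by simp
      then show ?thesis using \<kappa>_eq[OF d e] by simp
    qed
    show "\<kappa> (rotate_dart d) \<longleftrightarrow> \<not> \<kappa> d"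
      by (rule flip) (use orb_step[OF e dX, of \<alpha>] in \<open>simp_all add: \<alpha>_def\<close>)
    show "\<kappa> (glue D d) \<longleftrightarrow> \<not> \<kappa> d"
      by (rule flip) (use orb_step[OF e dX, of \<beta>] in \<open>simp_all add: \<beta>_def\<close>)
  qed
  then have "checkerboard D \<kappa>" by (simp add: checkerboard_def)
  then show thesis by (rule that)
qed

lemma checkerboard_crossing:
  assumes "checkerboard D \<kappa>" "c < crossings D"
  shows "\<kappa> (c, 1) \<longleftrightarrow> \<not> \<kappa> (c, 0)" "\<kappa> (c, 2) \<longleftrightarrow> \<kappa> (c, 0)" "\<kappa> (c, 3) \<longleftrightarrow> \<not> \<kappa> (c, 0)"
proof -
  have rot: "\<kappa> (rotate_dart (c, q)) \<longleftrightarrow> \<not> \<kappa> (c, q)" if "q < 4" for q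
    using assms that by (auto simp: checkerboard_def darts_def)
  have "rotate_dart (c, 0) = (c, 1)" "rotate_dart (c, 1) = (c, 2)" "rotate_dart (c, 2) = (c, 3)"
    by simp_all
  with rot[of 0] rot[of 1] rot[of 2]
  show "\<kappa> (c, 1) \<longleftrightarrow> \<not> \<kappa> (c, 0)" "\<kappa> (c, 2) \<longleftrightarrow> \<kappa> (c, 0)" "\<kappa> (c, 3) \<longleftrightarrow> \<not> \<kappa> (c, 0)"
    by (simp_all del: rotate_dart.simps)
qed

lemma checkerboard_splitting:
  assumes "checkerboard D \<kappa>" "d \<in> darts D"
  shows "\<kappa> (splitting s d) \<longleftrightarrow> \<not> \<kappa> d"
proof -
  obtain c p where "d = (c, p)" "c < crossings D" "p < 4"
    using assms(2) by (auto simp: darts_def)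
  with checkerboard_crossing[OF assms(1), of c] show ?thesis
    by (auto elim!: less_4_cases)
qed

section \<open>Circles under the change of one marker\<close>

lemma card_circles: "card (circles D s) = card (orbs {glue D, splitting s} (darts D)) + free_circles D"
  unfolding circles_def by (subst card_Plus) (simp_all add: orbs_def)

context
  fixes D :: link_diagram and s :: state and c :: nat
  assumes D: "oriented_link_diagram D" and c: "c < crossings D" "c \<notin> s"
begin

text \<open>Normalise the colouring so that darts 0 and 2 at \<open>c\<close> are coloured; then 1
  and 3 are not. The \<open>A\<close>-splitting sends 0 to 1 and 2 to 3, the
  \<open>B\<close>-splitting sends 0 to 3 and 2 to 1, so on coloured darts the two differ by
  exchanging 0 and 2.\<close>

lemma splitting_swap:
  obtains \<kappa> where
    "\<And>s. alternating_involutions (darts D) (glue D) (splitting s) \<kappa>"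
    "\<kappa> (c, 0)" "\<kappa> (c, 2)"
    "\<And>x. x \<in> darts D \<Longrightarrow> \<kappa> x \<Longrightarrow>
      splitting (insert c s) x = splitting s (transpose (c, 0) (c, 2) x)"
proof -
  obtain \<kappa>' where \<kappa>': "checkerboard D \<kappa>'"
    using checkerboard_exists[OF D] by blast
  define \<kappa> where "\<kappa> d \<longleftrightarrow> (\<kappa>' d \<longleftrightarrow> \<kappa>' (c, 0))" for d
  have \<kappa>: "checkerboard D \<kappa>"
    using \<kappa>' by (auto simp: checkerboard_def \<kappa>_def)
  have c0: "\<kappa> (c, 0)" by (simp add: \<kappa>_def)
  have c123: "\<not> \<kappa> (c, 1)" "\<kappa> (c, 2)" "\<not> \<kappa> (c, 3)"
    using c0 checkerboard_crossing[OF \<kappa> c(1)] by simp_all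
  show thesis
  proof (rule that[of \<kappa>])
    show "alternating_involutions (darts D) (glue D) (splitting s) \<kappa>" for s
      using oriented_glue[OF D] splitting_dart checkerboard_splitting[OF \<kappa>] \<kappa>
      by unfold_locales (auto simp: checkerboard_def)
    show "splitting (insert c s) x = splitting s (transpose (c, 0) (c, 2) x)"
      if asm: "x \<in> darts D" "\<kappa> x" for x
    proof (cases "fst x = c")
      case True
      then obtain p where "x = (c, p)" "p < 4"
        using asm by (cases x) (auto simp: darts_def)
      with asm c123 c show ?thesis by (auto simp: transpose_def elim!: less_4_cases)
    next
      case False
      then show ?thesis by (cases x) (auto simp: transpose_def)
    qed
  qed (use c0 c123 in auto)
qed

lemma darts_at_crossing: "(c, 0) \<in> darts D" "(c, 1) \<in> darts D" "(c, 2) \<in> darts D" "(c, 3) \<in> darts D"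
  using c by (simp_all add: darts_def)

lemma crossing_change_parity:
  "even (card (circles D (insert c s))) \<longleftrightarrow> odd (card (circles D s))"
proof -
  obtain \<kappa> where \<kappa>: "\<And>s. alternating_involutions (darts D) (glue D) (splitting s) \<kappa>"
    "\<kappa> (c, 0)" "\<kappa> (c, 2)"
    "\<And>x. x \<in> darts D \<Longrightarrow> \<kappa> x \<Longrightarrow>
      splitting (insert c s) x = splitting s (transpose (c, 0) (c, 2) x)"
    by (rule splitting_swap) (rule that)
  show ?thesis
    using alternating_involutions.swap(1)[OF \<kappa>(1) \<kappa>(1) _ _ \<kappa>(2,3) _ \<kappa>(4)] darts_at_crossing
    by (auto simp: card_circles)
qed

text \<open>In a merge \<open>edge_map\<close> writes the product at the circle through
  \<open>(c, 0)\<close> and copies all other factors. The circle through \<open>(c, 2)\<close> must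
  therefore be the same one, or a factor would be copied from a circle that the old state
  lacks.\<close>

lemma crossing_change_merge:
  assumes "circle_at D s (c, 0) \<noteq> circle_at D s (c, 2)"
  shows "circle_at D (insert c s) (c, 0) = circle_at D (insert c s) (c, 2)"
proof -
  obtain \<kappa> where \<kappa>: "\<And>s. alternating_involutions (darts D) (glue D) (splitting s) \<kappa>"
    "\<kappa> (c, 0)" "\<kappa> (c, 2)"
    "\<And>x. x \<in> darts D \<Longrightarrow> \<kappa> x \<Longrightarrow>
      splitting (insert c s) x = splitting s (transpose (c, 0) (c, 2) x)"
    by (rule splitting_swap) (rule that)
  note P = alternating_involutions.permutes_all_fg[OF \<kappa>(1)]
  have "(c, 2) \<notin> orb {glue D, splitting s} (darts D) (c, 0)"
    using assms orb_eq_iff[OF P darts_at_crossing(1)] by (auto simp: circle_at_def)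
  then have "(c, 2) \<in> orb {glue D, splitting (insert c s)} (darts D) (c, 0)"
    using alternating_involutions.swap(2)[OF \<kappa>(1) \<kappa>(1) _ _ \<kappa>(2,3) _ \<kappa>(4)] darts_at_crossing
    by simp
  then show ?thesis
    using orb_eq_iff[OF P darts_at_crossing(1)] by (auto simp: circle_at_def)
qed

lemma permutes_all_splitting: "permutes_all {glue D, splitting s'} (darts D)"
proof -
  have "permutes_all {glue D} (darts D)"
    by (rule permutes_all_involution) (use oriented_glue[OF D] in auto)
  moreover have "permutes_all {splitting s'} (darts D)"
    by (rule permutes_all_involution) (rule finite_darts, rule splitting_dart)
  ultimately show ?thesis
    using permutes_all_insert by blast
qed

text \<open>A circle that avoids darts 0 and 2 at \<open>c\<close> avoids this crossing altogether,
  and elsewhere the two splittings agree. This guarantees that the factors copied by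
  \<open>edge_map\<close> exist in the old state.\<close>

lemma other_circles:
  assumes e: "e \<in> circles D (insert c s)"
    and ne: "e \<noteq> circle_at D (insert c s) (c, 0)" "e \<noteq> circle_at D (insert c s) (c, 2)"
  shows "e \<in> circles D s"
proof (cases e)
  case (Inr k)
  with e show ?thesis by (auto simp: circles_def)
next
  case (Inl S)
  let ?t = "insert c s"
  let ?O = "orb {glue D, splitting s} (darts D)" and ?O' = "orb {glue D, splitting ?t} (darts D)"
  obtain x where x: "x \<in> darts D" "S = ?O' x"
    using e Inl by (auto simp: circles_def orbs_def)
  have sub: "S \<subseteq> darts D"
    using orb_subset[OF permutes_all_splitting x(1)] x(2) by blast
  have eqS: "?O' y = S" if "y \<in> S" for y
    using orb_eq_iff[OF permutes_all_splitting x(1)] that x(2) by blast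
  have no02: "(c, 0) \<notin> S" "(c, 2) \<notin> S"
    using ne Inl eqS by (auto simp: circle_at_def)
  have no: "fst y \<noteq> c" if y: "y \<in> S" for y
  proof
    assume "fst y = c"
    then obtain p where p: "y = (c, p)" "p < 4"
      using y sub by (cases y) (auto simp: darts_def)
    \<comment> \<open>For \<open>insert c s\<close>, dart 1 is paired with 2 and dart 3 with 0, so a
      circle passing through \<open>c\<close> would contain an excluded dart.\<close>
    have "splitting ?t y \<in> S"
      using orb_step[of y "{glue D, splitting ?t}" "darts D" y "splitting ?t"] y sub eqS[OF y] by auto
    with p y no02 show False by (auto elim!: less_4_cases)
  qed
  have same: "splitting ?t y = splitting s y" if "y \<in> S" for y
    using no[OF that] by (cases y) auto
  have xS: "x \<in> S" using x by simp
  have closed: "f y \<in> S" if "y \<in> S" "f \<in> {glue D, splitting ?t}" for f y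
    using orb_step[of y "{glue D, splitting ?t}" "darts D" x f] that sub x(2) by auto
  have "f y \<in> S" if "y \<in> S" "f \<in> {glue D, splitting s}" for f y
    using that closed[of y "glue D"] closed[of y "splitting ?t"] same[of y]
    by (auto simp del: splitting.simps split_paired_All)
  then have "?O x \<subseteq> S"
    by (intro orb_subset_closed[OF xS])
  moreover have "S \<subseteq> ?O x"
  proof
    fix y assume "y \<in> S"
    then have "y \<in> ?O' x" using x(2) by simp
    then show "y \<in> ?O x"
    proof (induction rule: orb_induct)
      case (step y f)
      then have "f y = glue D y \<or> f y = splitting s y"
        using same[of y] x(2) by blast
      moreover have "glue D y \<in> ?O x"
        by (rule orb_step[OF step(4) step(2)]) blast
      moreover have "splitting s y \<in> ?O x"
        by (rule orb_step[OF step(4) step(2)]) blast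
      ultimately show ?case by metis
    qed simp
  qed
  ultimately show ?thesis
    using x(1) Inl by (auto simp: circles_def orbs_def)
qed

end

section \<open>Parity of the number of circles and of the number of components\<close>

lemma circles_parity:
  assumes D: "oriented_link_diagram D" and s: "s \<in> states D"
  shows "even (card (circles D s) + num_b s) \<longleftrightarrow> even (size_sA D)"
proof -
  have "finite s" using s finite_subset[of s "{..<crossings D}"] by (simp add: states_def)
  then show ?thesis using s
  proof (induction s rule: finite_induct)
    case empty
    show ?case by (simp add: num_b_def size_sA_def)
  next
    case (insert c s)
    then have cs: "c < crossings D" "s \<in> states D" by (auto simp: states_def)
    show ?case
      using insert.hyps insert.IH[OF cs(2)] crossing_change_parity[OF D cs(1), of s]
      by (simp add: num_b_def)
  qed
qed

lemma crossings_eq: "crossings D = n_plus D + n_minus D"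
proof -
  have "{..<crossings D} = {c. c < crossings D \<and> positive D c} \<union> {c. c < crossings D \<and> \<not> positive D c}"
    by auto
  then have "card {..<crossings D} = n_plus D + n_minus D"
    unfolding n_plus_def n_minus_def by (simp only:) (subst card_Un_disjoint, auto)
  then show ?thesis by simp
qed

text \<open>\<open>opposite\<close> preserves a checkerboard colouring, so the colouring used here
  is by orientation: gluing, \<open>opposite\<close> and the Seifert splitting all exchange incoming
  and outgoing darts. Smoothing the crossings one at a time gives N + n_+ + n_- for the parity of
  the number of Seifert circles. The Seifert state has n_- markers \<open>B\<close>, so this parity
  is also that of |s_A| + n_-.\<close>

lemma components_parity:
  assumes D: "oriented_link_diagram D"
  shows "even (num_components D) \<longleftrightarrow> even (n_plus D + size_sA D)"
proof -
  \<comment> \<open>The Seifert state: the orientation is respected by the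
    \<open>A\<close>-splitting at positive crossings and by the \<open>B\<close>-splitting at
    negative ones.\<close>
  define s where "s = {c. c < crossings D \<and> \<not> positive D c}"
  \<comment> \<open>Only the crossings in \<open>S\<close> are smoothed; strands run straight
    through the others.\<close>
  define h where "h S = (\<lambda>(c, p). if c \<in> S then splitting s (c, p) else opposite (c, p))" for S
  have h_cases: "h S x = (if fst x \<in> S then splitting s x else opposite x)" for S x
    by (cases x) (auto simp: h_def)
  have fst_h: "fst (h S x) = fst x" for S x
    by (cases x) (auto simp: h_def)
  have out_s: "outgoing D (splitting s d) \<longleftrightarrow> \<not> outgoing D d" if "d \<in> darts D" for d
    using that by (elim dart_cases) (simp_all add: s_def)
  have alt: "alternating_involutions (darts D) (glue D) (h S) (outgoing D)" for S
  proof
    fix x assume x: "x \<in> darts D"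
    show "h S x \<in> darts D \<and> h S (h S x) = x \<and> outgoing D (h S x) = (\<not> outgoing D x)"
      using x splitting_dart[OF x, of s] opposite_dart[OF x] out_s outgoing_opposite fst_h[of S x]
      by (auto simp: h_cases split: if_splits)
    show "glue D x \<in> darts D \<and> glue D (glue D x) = x \<and> outgoing D (glue D x) = (\<not> outgoing D x)"
      using oriented_glue[OF D x] by blast
  qed simp
  have parity: "even (card (orbs {glue D, h S} (darts D)) + card S) \<longleftrightarrow>
      even (card (orbs {glue D, opposite} (darts D)))"
    if "finite S" "S \<subseteq> {..<crossings D}" for S
    using that
  proof (induction S rule: finite_induct)
    case empty
    have "h {} = opposite" by (rule ext) (simp add: h_cases)
    then show ?case by simp
  next
    case (insert c S)
    \<comment> \<open>\<open>?b\<close> is the outgoing end of the overcrossing strand and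
      \<open>(c, 2)\<close> that of the undercrossing strand. Smoothing exchanges their
      partners.\<close>
    let ?b = "(c, if positive D c then 1 else 3)"
    have swap: "h (insert c S) x = h S (transpose (c, 2) ?b x)"
      if asm: "x \<in> darts D" "outgoing D x" for x
    proof (cases "fst x = c")
      case True
      then have "x = (c, 0) \<or> x = (c, 1) \<or> x = (c, 2) \<or> x = (c, 3)"
        using asm(1) by (elim dart_cases) simp_all
      moreover have "c \<in> s \<longleftrightarrow> \<not> positive D c"
        using insert.prems by (simp add: s_def)
      ultimately show ?thesis
        using asm(2) insert.hyps(2)
        by (cases "positive D c") (elim disjE; simp add: h_cases transpose_def)+
    next
      case False
      then have "transpose (c, 2) ?b x = x"
        by (cases x) (simp add: transpose_def)
      with False show ?thesis by (simp add: h_cases)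
    qed
    have "even (card (orbs {glue D, h (insert c S)} (darts D))) \<longleftrightarrow>
        odd (card (orbs {glue D, h S} (darts D)))"
      by (rule alternating_involutions.swap(1)[OF alt alt _ _ _ _ _ swap])
        (use insert in \<open>auto simp: darts_def\<close>)
    with insert show ?case by auto
  qed
  have "orbs (insert (h {..<crossings D}) {glue D}) (darts D)
      = orbs (insert (splitting s) {glue D}) (darts D)"
    by (rule orbs_cong(2)) (auto simp: h_cases darts_def)
  then have "even (card (orbs {glue D, splitting s} (darts D)) + crossings D) \<longleftrightarrow>
      even (card (orbs {glue D, opposite} (darts D)))"
    using parity[of "{..<crossings D}"] by (simp add: insert_commute)
  moreover have "even (card (circles D s) + n_minus D) \<longleftrightarrow> even (size_sA D)"
    using circles_parity[OF D, of s] by (auto simp: states_def s_def num_b_def n_minus_def)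
  moreover note card_circles[of D s]
  moreover note crossings_eq[of D]
  ultimately show ?thesis by (auto simp: num_components_def)
qed

section \<open>Quotients of direct sums\<close>

lemma surj_homs_same_kernel_iso:
  assumes "group A" "group B" "group C"
    and f: "f \<in> hom A B" "f ` carrier A = carrier B"
    and g: "g \<in> hom A C" "g ` carrier A = carrier C"
    and ker: "\<And>x. x \<in> carrier A \<Longrightarrow> f x = \<one>\<^bsub>B\<^esub> \<longleftrightarrow> g x = \<one>\<^bsub>C\<^esub>"
  shows "B \<cong> C"
proof -
  interpret f: group_hom A B f
    by (simp add: assms group_hom_def group_hom_axioms_def)
  interpret g: group_hom A C g
    by (simp add: assms group_hom_def group_hom_axioms_def)
  have "kernel A B f = kernel A C g"
    using ker by (auto simp: kernel_def)
  then have "A Mod kernel A B f \<cong> C"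
    using g.FactGroup_iso g by simp
  moreover have "B \<cong> A Mod kernel A B f"
    using f.FactGroup_iso f group.iso_sym normal.factorgroup_is_group f.normal_kernel by blast
  ultimately show ?thesis by (rule iso_trans[rotated])
qed

text \<open>
  The subgroup \<open>H\<close> is not assumed to be contained in \<open>M\<close>: the cosets of \<open>H\<close> by elements of \<open>M\<close>
  form the group \<open>(M + H) / H\<close>. Hence homology can be compared without first showing that the square
  of the differential vanishes.
\<close>

lemma Mod_carrier_update:
  "A\<lparr>carrier := M\<rparr> Mod H = (A Mod H)\<lparr>carrier := (\<lambda>x. H #>\<^bsub>A\<^esub> x) ` M\<rparr>"
  by (auto simp: FactGroup_def RCOSETS_def r_coset_def set_mult_def fun_eq_iff)

context comm_group
begin

lemma Mod_carrier_update_hom: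
  assumes M: "subgroup M G" and H: "subgroup H G"
  shows "group (G\<lparr>carrier := M\<rparr> Mod H)"
    and "(\<lambda>x. H #> x) \<in> hom (G\<lparr>carrier := M\<rparr>) (G\<lparr>carrier := M\<rparr> Mod H)"
    and "(\<lambda>x. H #> x) ` M = carrier (G\<lparr>carrier := M\<rparr> Mod H)"
    and "\<And>x. x \<in> M \<Longrightarrow> H #> x = \<one>\<^bsub>G\<lparr>carrier := M\<rparr> Mod H\<^esub> \<longleftrightarrow> x \<in> H"
proof -
  interpret H: normal H G
    by (rule subgroup_imp_normal[OF H])
  interpret q: group_hom G "G Mod H" "\<lambda>x. H #> x"
    by (simp add: group_hom_def group_hom_axioms_def is_group H.factorgroup_is_group H.r_coset_hom_Mod)
  show "group (G\<lparr>carrier := M\<rparr> Mod H)"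
    unfolding Mod_carrier_update
    using q.subgroup_img_is_subgroup[OF M] H.factorgroup_is_group
    by (simp add: group.subgroup_imp_group)
  show "(\<lambda>x. H #> x) \<in> hom (G\<lparr>carrier := M\<rparr>) (G\<lparr>carrier := M\<rparr> Mod H)"
    unfolding Mod_carrier_update
    using H.r_coset_hom_Mod subgroup.subset[OF M] by (simp add: hom_def subset_iff)
  show "(\<lambda>x. H #> x) ` M = carrier (G\<lparr>carrier := M\<rparr> Mod H)"
    unfolding Mod_carrier_update by simp
  show "H #> x = \<one>\<^bsub>G\<lparr>carrier := M\<rparr> Mod H\<^esub> \<longleftrightarrow> x \<in> H" if "x \<in> M" for x
  proof -
    have x: "x \<in> carrier G" using that subgroup.subset[OF M] by blast
    have "H #> x = H \<longleftrightarrow> x \<in> H"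
      using coset_join1[OF _ x H] coset_join2[OF x H] subgroup.subset[OF H] by blast
    then show ?thesis by (simp add: FactGroup_def)
  qed
qed

end

text \<open>Both sides are images of \<open>M\<close>: under cosets of \<open>H\<close>, and under
  families of cosets of the values \<open>\<pi> k u\<close>. The assumption \<open>iff\<close> makes
  the kernels equal and \<open>surj\<close> makes the second map onto. The set \<open>K\<close> will
  be an infinite parity class of integers, while elements of a sum group have finite support; this
  is what \<open>fin\<close> provides.\<close>

lemma Mod_iso_sum_group:
  fixes A :: "'a monoid" and B :: "'k \<Rightarrow> 'b monoid"
  assumes A: "comm_group A" "subgroup M A" "subgroup H A"
    and B: "\<And>k. k \<in> K \<Longrightarrow> comm_group (B k)" "\<And>k. k \<in> K \<Longrightarrow> subgroup (N k) (B k)"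
      "\<And>k. k \<in> K \<Longrightarrow> subgroup (I k) (B k)"
    and \<pi>: "\<And>k. k \<in> K \<Longrightarrow> \<pi> k \<in> hom A (B k)"
    and mem: "\<And>k u. k \<in> K \<Longrightarrow> u \<in> M \<Longrightarrow> \<pi> k u \<in> N k"
    and iff: "\<And>u. u \<in> M \<Longrightarrow> u \<in> H \<longleftrightarrow> (\<forall>k\<in>K. \<pi> k u \<in> I k)"
    and fin: "\<And>u. u \<in> M \<Longrightarrow> finite {k \<in> K. \<pi> k u \<notin> I k}"
    and surj: "\<And>y. (\<And>k. k \<in> K \<Longrightarrow> y k \<in> N k) \<Longrightarrow> \<exists>u\<in>M. \<forall>k\<in>K. \<pi> k u = y k"
  shows "A\<lparr>carrier := M\<rparr> Mod H \<cong> sum_group K (\<lambda>k. B k\<lparr>carrier := N k\<rparr> Mod I k)"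
    (is "?Q \<cong> sum_group K ?R")
proof -
  interpret A: comm_group A by (fact A(1))
  note Q = A.Mod_carrier_update_hom[OF A(2,3)]
  note R = comm_group.Mod_carrier_update_hom[OF B]
  let ?\<theta> = "\<lambda>u. \<lambda>k\<in>K. I k #>\<^bsub>B k\<^esub> \<pi> k u"
  have carrier: "carrier (sum_group K ?R) =
      {y \<in> (\<Pi>\<^sub>E k\<in>K. carrier (?R k)). finite {k \<in> K. y k \<noteq> \<one>\<^bsub>?R k\<^esub>}}"
    by (rule carrier_sum_group) (rule R(1))
  have one: "I k #>\<^bsub>B k\<^esub> \<pi> k u = \<one>\<^bsub>?R k\<^esub> \<longleftrightarrow> \<pi> k u \<in> I k" if "k \<in> K" "u \<in> M" for k u
    using R(4)[of k "\<pi> k u"] that mem by simp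
  have closed: "?\<theta> u \<in> carrier (sum_group K ?R)" if u: "u \<in> M" for u
  proof -
    have "I k #>\<^bsub>B k\<^esub> \<pi> k u \<in> carrier (?R k)" if "k \<in> K" for k
      using R(3)[OF that that that] mem[OF that u] by blast
    moreover have "{k \<in> K. ?\<theta> u k \<noteq> \<one>\<^bsub>?R k\<^esub>} = {k \<in> K. \<pi> k u \<notin> I k}"
      using one u by auto
    ultimately show ?thesis
      unfolding carrier using fin[OF u] by simp
  qed
  show ?thesis
  proof (rule surj_homs_same_kernel_iso[OF _ Q(1) _ Q(2)])
    show "group (A\<lparr>carrier := M\<rparr>)"
      by (rule A.subgroup_imp_group[OF A(2)])
    show "group (sum_group K ?R)"
      by (rule sum_group) (rule R(1))
    show "(\<lambda>x. H #>\<^bsub>A\<^esub> x) ` carrier (A\<lparr>carrier := M\<rparr>) = carrier ?Q"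
      using Q(3) by simp
    show "?\<theta> \<in> hom (A\<lparr>carrier := M\<rparr>) (sum_group K ?R)"
    proof (rule homI)
      fix u v assume uv: "u \<in> carrier (A\<lparr>carrier := M\<rparr>)" "v \<in> carrier (A\<lparr>carrier := M\<rparr>)"
      then have uA: "u \<in> carrier A" "v \<in> carrier A"
        using subgroup.subset[OF A(2)] by auto
      have "I k #>\<^bsub>B k\<^esub> \<pi> k (u \<otimes>\<^bsub>A\<^esub> v) = (I k #>\<^bsub>B k\<^esub> \<pi> k u) \<otimes>\<^bsub>?R k\<^esub> (I k #>\<^bsub>B k\<^esub> \<pi> k v)"
        if k: "k \<in> K" for k
        using hom_mult[OF R(2)[OF k k k], of "\<pi> k u" "\<pi> k v"] hom_mult[OF \<pi>[OF k] uA] mem[OF k] uv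
        by simp
      then show "?\<theta> (u \<otimes>\<^bsub>A\<lparr>carrier := M\<rparr>\<^esub> v) = ?\<theta> u \<otimes>\<^bsub>sum_group K ?R\<^esub> ?\<theta> v"
        by (auto intro: restrict_ext)
    qed (use closed in simp)
    show "?\<theta> ` carrier (A\<lparr>carrier := M\<rparr>) = carrier (sum_group K ?R)"
    proof (intro subset_antisym subsetI)
      fix y assume y: "y \<in> carrier (sum_group K ?R)"
      then have "\<exists>x\<in>N k. y k = I k #>\<^bsub>B k\<^esub> x" if "k \<in> K" for k
      proof -
        have "y k \<in> (\<lambda>x. I k #>\<^bsub>B k\<^esub> x) ` N k"
          unfolding R(3)[OF that that that] using y that unfolding carrier by (auto simp: PiE_iff)
        then show ?thesis by blast
      qed
      then obtain x where x: "\<And>k. k \<in> K \<Longrightarrow> x k \<in> N k \<and> y k = I k #>\<^bsub>B k\<^esub> x k"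
        by metis
      then obtain u where u: "u \<in> M" "\<And>k. k \<in> K \<Longrightarrow> \<pi> k u = x k"
        using surj[of x] by blast
      have "y = ?\<theta> u"
        using y x u(2) unfolding carrier by (auto simp: PiE_iff extensional_def fun_eq_iff)
      with u(1) show "y \<in> ?\<theta> ` carrier (A\<lparr>carrier := M\<rparr>)" by simp
    qed (use closed in auto)
    show "H #>\<^bsub>A\<^esub> u = \<one>\<^bsub>?Q\<^esub> \<longleftrightarrow> ?\<theta> u = \<one>\<^bsub>sum_group K ?R\<^esub>"
      if "u \<in> carrier (A\<lparr>carrier := M\<rparr>)" for u
    proof -
      have u: "u \<in> M" using that by simp
      have "?\<theta> u = \<one>\<^bsub>sum_group K ?R\<^esub> \<longleftrightarrow> (\<forall>k\<in>K. \<pi> k u \<in> I k)"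
        using one u by (auto simp: fun_eq_iff restrict_def)
      then show ?thesis
        using Q(4)[OF u] iff[OF u] by simp
    qed
  qed
qed

section \<open>Comparison of the cubes\<close>

definition tensor_map :: "('g \<Rightarrow> 'h) \<Rightarrow> circle set \<Rightarrow> 'g tensor \<Rightarrow> 'h tensor" where
  "tensor_map r X = frag_extend (\<lambda>x. frag_of (\<lambda>e\<in>X. r (x e)))"

lemma tensor_map_simps [simp]:
  "tensor_map r X 0 = 0"
  "tensor_map r X (frag_of x) = frag_of (\<lambda>e\<in>X. r (x e))"
  "tensor_map r X (frag_cmul k a) = frag_cmul k (tensor_map r X a)"
  "tensor_map r X (a + b) = tensor_map r X a + tensor_map r X b"
  "tensor_map r X (a - b) = tensor_map r X a - tensor_map r X b"
  by (simp_all add: tensor_map_def frag_extend_cmul frag_extend_add frag_extend_diff)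

lemma tensor_map_sum: "tensor_map r X (sum f I) = (\<Sum>i\<in>I. tensor_map r X (f i))"
  by (induction I rule: infinite_finite_induct) simp_all

lemma keys_tensor_map: "Poly_Mapping.keys (tensor_map r X a) \<subseteq> (\<lambda>x. \<lambda>e\<in>X. r (x e)) ` Poly_Mapping.keys a"
  unfolding tensor_map_def using keys_frag_extend by (fastforce simp: keys_frag_of)

lemma tensor_map_inverse:
  assumes "Poly_Mapping.keys a \<subseteq> X \<rightarrow>\<^sub>E UNIV" "\<And>y. r' (r y) = y"
  shows "tensor_map r' X (tensor_map r X a) = a"
  using assms(1)
proof (induction a rule: frag_induction)
  case (one x)
  then have "(\<lambda>e\<in>X. r' ((\<lambda>e\<in>X. r (x e)) e)) = x"
    by (auto simp: assms(2) PiE_iff extensional_def fun_eq_iff)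
  then show ?case by simp
qed simp_all

fun v_of_w :: "wgen \<Rightarrow> vgen" where
  "v_of_w w_plus = v_minus"
| "v_of_w w_minus = v_plus"

fun w_of_v :: "vgen \<Rightarrow> wgen" where
  "w_of_v v_plus = w_minus"
| "w_of_v v_minus = w_plus"

lemma v_of_w_of_v [simp]: "v_of_w (w_of_v y) = y"
  by (cases y) simp_all

lemma w_of_v_of_w [simp]: "w_of_v (v_of_w y) = y"
  by (cases y) simp_all

lemma w_deg_eq: "w_deg y = -2 * v_deg (v_of_w y)"
  by (cases y) simp_all

lemma keys_frag_extend_subset:
  "(\<And>x. x \<in> Poly_Mapping.keys a \<Longrightarrow> Poly_Mapping.keys (f x) \<subseteq> S) \<Longrightarrow>
    Poly_Mapping.keys (frag_extend f a) \<subseteq> S"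
  using keys_frag_extend[of f a] by blast

lemma keys_edge_map:
  "Poly_Mapping.keys (edge_map F D s c a) \<subseteq> circles D (insert c s) \<rightarrow>\<^sub>E UNIV"
  unfolding edge_map_def Let_def
  by (intro keys_frag_extend_subset) (auto simp: keys_frag_of split: prod.split intro!: keys_frag_extend_subset)

lemma edge_map_simps:
  "edge_map F D s c 0 = 0"
  "edge_map F D s c (a + b) = edge_map F D s c a + edge_map F D s c b"
  "edge_map F D s c (a - b) = edge_map F D s c a - edge_map F D s c b"
  by (simp_all add: edge_map_def Let_def frag_extend_add frag_extend_diff)

lemma circle_at_mem:
  "c < crossings D \<Longrightarrow> p < 4 \<Longrightarrow> circle_at D s (c, p) \<in> circles D s"
  by (auto simp: circle_at_def circles_def orbs_def darts_def)

text \<open>By linearity one generator \<open>x\<close> suffices. The exchange of signs matches the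
  structure maps of \<open>W\<close> with those of \<open>V\<close>; the remaining point is that
  every copied factor belongs to a circle of \<open>s\<close>, since \<open>y\<close> carries the
  exchanged generators only there.\<close>

lemma tensor_map_edge_map:
  assumes D: "oriented_link_diagram D" and c: "c < crossings D" "c \<notin> s"
    and a: "Poly_Mapping.keys a \<subseteq> circles D s \<rightarrow>\<^sub>E UNIV"
  shows "tensor_map v_of_w (circles D (insert c s)) (edge_map W D s c a) =
    edge_map V D s c (tensor_map v_of_w (circles D s) a)"
  using a
proof (induction a rule: frag_induction)
  case (one x)
  let ?C = "circles D s" and ?C' = "circles D (insert c s)"
  let ?p = "circle_at D s (c, 0)" and ?q = "circle_at D s (c, 2)"
  let ?p' = "circle_at D (insert c s) (c, 0)" and ?q' = "circle_at D (insert c s) (c, 2)"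
  define y where "y = (\<lambda>e\<in>?C. v_of_w (x e))"
  have pq: "?p \<in> ?C" "?q \<in> ?C"
    using c by (simp_all add: circle_at_mem)
  have x_y: "tensor_map v_of_w ?C (frag_of x) = frag_of y"
    by (simp add: y_def)
  have y_pq: "y ?p = v_of_w (x ?p)" "y ?q = v_of_w (x ?q)"
    using pq by (simp_all add: y_def)
  have other: "e \<in> ?C" if "e \<in> ?C'" "e \<noteq> ?p'" "e \<noteq> ?q'" for e
    using other_circles[OF D c] that by blast
  show ?case
  proof (cases "?p = ?q")
    case False
    then have "?p' = ?q'"
      by (rule crossing_change_merge[OF D c])
    then have "(\<lambda>e\<in>?C'. v_of_w ((\<lambda>e\<in>?C'. if e = ?p' then g else x e) e)) =
        (\<lambda>e\<in>?C'. if e = ?p' then v_of_w g else y e)" for g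
      using other by (auto simp: y_def fun_eq_iff)
    then have "tensor_map v_of_w ?C' (frag_of (\<lambda>e\<in>?C'. if e = ?p' then g else x e)) =
        frag_of (\<lambda>e\<in>?C'. if e = ?p' then v_of_w g else y e)" for g
      by (simp only: tensor_map_simps)
    then show ?thesis
      using False y_pq
      by (cases "x ?p"; cases "x ?q")
        (simp_all add: x_y edge_map_def Let_def W_def V_def del: tensor_map_simps(2) cong: if_cong)
  next
    case True
    have "(\<lambda>e\<in>?C'. v_of_w ((\<lambda>e\<in>?C'. if e = ?p' then g else if e = ?q' then h else x e) e)) =
        (\<lambda>e\<in>?C'. if e = ?p' then v_of_w g else if e = ?q' then v_of_w h else y e)" for g h
      using other by (auto simp: y_def fun_eq_iff)
    then have "tensor_map v_of_w ?C'
          (frag_of (\<lambda>e\<in>?C'. if e = ?p' then g else if e = ?q' then h else x e)) =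
        frag_of (\<lambda>e\<in>?C'. if e = ?p' then v_of_w g else if e = ?q' then v_of_w h else y e)" for g h
      by (simp only: tensor_map_simps)
    then show ?thesis
      using True y_pq
      \<comment> \<open>Commutativity is used because the exchange reverses the two terms of the
        comultiplication.\<close>
      by (cases "x ?p")
        (simp_all add: x_y edge_map_def Let_def W_def V_def frag_extend_add add.commute
          del: tensor_map_simps(2) cong: if_cong)
  qed
qed (simp_all add: edge_map_simps)

text \<open>The comparison is made at a single state because the two cubes are indexed differently:
  \<open>T\<close> will be a parity class of states, \<open>T'\<close> a single level. The value at
  \<open>t\<close> involves only the states \<open>t - {c}\<close>.\<close>

lemma tensor_map_cube_map:
  assumes D: "oriented_link_diagram D" and t: "t \<in> states D" "t \<in> T" "t \<in> T'"
    and u: "\<And>c. c \<in> t \<Longrightarrow> Poly_Mapping.keys (u (t - {c})) \<subseteq> circles D (t - {c}) \<rightarrow>\<^sub>E UNIV"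
    and v: "\<And>c. c \<in> t \<Longrightarrow> v (t - {c}) = tensor_map v_of_w (circles D (t - {c})) (u (t - {c}))"
  shows "cube_map V D T' v t = tensor_map v_of_w (circles D t) (cube_map W D T u t)"
proof -
  have "edge_map V D (t - {c}) c (v (t - {c})) =
      tensor_map v_of_w (circles D t) (edge_map W D (t - {c}) c (u (t - {c})))" if c: "c \<in> t" for c
  proof -
    have "c < crossings D" "insert c (t - {c}) = t"
      using t(1) c by (auto simp: states_def)
    then show ?thesis
      using tensor_map_edge_map[OF D _ _ u[OF c], of c] v[OF c] by simp
  qed
  then show ?thesis
    using t by (simp add: cube_map_def tensor_map_sum)
qed

lemma keys_cube_map:
  assumes "t \<in> T"
  shows "Poly_Mapping.keys (cube_map F D T u t) \<subseteq> circles D t \<rightarrow>\<^sub>E UNIV"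
proof -
  have "Poly_Mapping.keys (frag_cmul k (edge_map F D (t - {c}) c a)) \<subseteq> circles D t \<rightarrow>\<^sub>E UNIV"
    if "c \<in> t" for k c a
    using keys_edge_map[of F D "t - {c}" c a] keys_cmul that by (fastforce simp: insert_absorb)
  then show ?thesis
    using assms keys_sum unfolding cube_map_def by fastforce
qed

text \<open>An ambient group for families over \<open>S\<close> that mentions neither degrees nor
  circles. The cube maps are homomorphisms between such groups, and the homology in each degree is a
  quotient formed from subgroups of one of them.\<close>

definition tensor_families :: "'s set \<Rightarrow> ('s \<Rightarrow> 'b \<Rightarrow>\<^sub>0 int) monoid" where
  "tensor_families S = product_group S (\<lambda>_. free_Abelian_group UNIV)"

definition families_in :: "'s set \<Rightarrow> ('s \<Rightarrow> 'b set) \<Rightarrow> ('s \<Rightarrow> 'b \<Rightarrow>\<^sub>0 int) set" where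
  "families_in S B = (\<Pi>\<^sub>E s\<in>S. {a. Poly_Mapping.keys a \<subseteq> B s})"

lemma tensor_families_simps [simp]:
  "carrier (tensor_families S) = S \<rightarrow>\<^sub>E UNIV"
  "\<one>\<^bsub>tensor_families S\<^esub> = (\<lambda>s\<in>S. 0)"
  "u \<otimes>\<^bsub>tensor_families S\<^esub> v = (\<lambda>s\<in>S. u s + v s)"
  by (auto simp: tensor_families_def free_Abelian_group_def)

lemma comm_group_tensor_families: "comm_group (tensor_families S)"
proof (rule group.group_comm_groupI)
  show "group (tensor_families S)"
    by (simp add: tensor_families_def)
qed (simp add: add.commute)

lemma subgroup_families_in: "subgroup (families_in S B) (tensor_families S)"
proof -
  have "subgroup {a. Poly_Mapping.keys a \<subseteq> C} (free_Abelian_group UNIV)" for C :: "'b set"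
  proof
    show "x \<otimes>\<^bsub>free_Abelian_group UNIV\<^esub> y \<in> {a. Poly_Mapping.keys a \<subseteq> C}"
      if "x \<in> {a. Poly_Mapping.keys a \<subseteq> C}" "y \<in> {a. Poly_Mapping.keys a \<subseteq> C}" for x y
      using that keys_add[of x y] by auto
  qed (auto simp: fun_eq_iff)
  then show ?thesis
    unfolding families_in_def tensor_families_def by (simp add: PiE_subgroup_product_group)
qed

text \<open>Over a finite index set the finite support condition is void, so the direct sum is a
  subgroup of the full product.\<close>

lemma sum_group_free_Abelian_group:
  assumes "finite S"
  shows "sum_group S (\<lambda>s. free_Abelian_group (B s)) = (tensor_families S)\<lparr>carrier := families_in S B\<rparr>"
proof (rule monoid.equality)
  have "carrier (free_Abelian_group (B s)) = {a. Poly_Mapping.keys a \<subseteq> B s}" for s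
    by auto
  then have "carrier (sum_group S (\<lambda>s. free_Abelian_group (B s))) = families_in S B"
    using assms by (simp add: carrier_sum_group families_in_def)
  then show "carrier (sum_group S (\<lambda>s. free_Abelian_group (B s))) =
      carrier ((tensor_families S)\<lparr>carrier := families_in S B\<rparr>)"
    by simp
qed (auto simp: fun_eq_iff)

lemma cube_map_hom:
  assumes "\<And>t c. t \<in> T \<Longrightarrow> c \<in> t \<Longrightarrow> t - {c} \<in> S"
  shows "cube_map F D T \<in> hom (tensor_families S) (tensor_families T)"
proof (rule homI)
  fix u v :: "state \<Rightarrow> 'a tensor"
  show "cube_map F D T (u \<otimes>\<^bsub>tensor_families S\<^esub> v) =
      cube_map F D T u \<otimes>\<^bsub>tensor_families T\<^esub> cube_map F D T v"
    using assms
    by (auto simp: cube_map_def fun_eq_iff edge_map_simps frag_cmul_distrib2 sum.distrib)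
qed (simp add: cube_map_def)

lemma homology_at_families:
  assumes "finite S" "finite T"
  shows "homology_at Z g (sum_group S (\<lambda>s. free_Abelian_group (B s))) f (sum_group T (\<lambda>t. free_Abelian_group (B' t)))
    = (tensor_families S)\<lparr>carrier := {u \<in> families_in S B. f u = (\<lambda>t\<in>T. 0)}\<rparr> Mod (g ` carrier Z)"
  using assms by (simp add: homology_at_def sum_group_free_Abelian_group kernel_def)

lemma subgroup_cycles:
  assumes "\<And>t c. t \<in> T \<Longrightarrow> c \<in> t \<Longrightarrow> t - {c} \<in> S"
  shows "subgroup {u \<in> families_in S B. cube_map F D T u = (\<lambda>t\<in>T. 0)} (tensor_families S)"
proof -
  interpret group_hom "tensor_families S" "tensor_families T" "cube_map F D T"
    using comm_group_tensor_families cube_map_hom[OF assms]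
    by (auto simp: group_hom_def group_hom_axioms_def comm_group_def)
  have "{u \<in> families_in S B. cube_map F D T u = (\<lambda>t\<in>T. 0)} =
      families_in S B \<inter> kernel (tensor_families S) (tensor_families T) (cube_map F D T)"
    by (auto simp: kernel_def families_in_def)
  then show ?thesis
    using subgroup_Int[OF subgroup_families_in subgroup_kernel] by simp
qed

lemma subgroup_boundaries:
  assumes "\<And>s c. s \<in> S \<Longrightarrow> c \<in> s \<Longrightarrow> s - {c} \<in> T"
  shows "subgroup (cube_map F D S ` families_in T B) (tensor_families S)"
proof -
  interpret group_hom "tensor_families T" "tensor_families S" "cube_map F D S"
    using comm_group_tensor_families cube_map_hom[OF assms]
    by (auto simp: group_hom_def group_hom_axioms_def comm_group_def)
  show ?thesis
    by (rule subgroup_img_is_subgroup[OF subgroup_families_in])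
qed

section \<open>Homogeneous bases and the indexing of states\<close>

definition w_basis :: "link_diagram \<Rightarrow> int \<Rightarrow> state \<Rightarrow> (circle \<Rightarrow> wgen) set" where
  "w_basis D J s = {x \<in> circles D s \<rightarrow>\<^sub>E UNIV.
    (\<Sum>e\<in>circles D s. w_deg (x e)) = J - (int (num_a D s) - int (num_b s))}"

definition v_basis :: "link_diagram \<Rightarrow> int \<Rightarrow> state \<Rightarrow> (circle \<Rightarrow> vgen) set" where
  "v_basis D q s = {x \<in> circles D s \<rightarrow>\<^sub>E UNIV. (\<Sum>e\<in>circles D s. v_deg (x e)) = q - int (num_b s)}"

lemma graded_sum_W_state:
  "graded_sum S (W_state D) J = sum_group S (\<lambda>s. free_Abelian_group (w_basis D J s))"
  by (simp add: graded_sum_def W_state_def shift_def tensor_power_def W_def w_basis_def)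

lemma graded_sum_V_state:
  "graded_sum S (V_state D) q = sum_group S (\<lambda>s. free_Abelian_group (v_basis D q s))"
  by (simp add: graded_sum_def V_state_def shift_def tensor_power_def V_def v_basis_def)

lemma finite_states: "finite (states D)"
  by (simp add: states_def)

lemma finite_parity_states: "finite (parity_states D i)"
  using finite_states by (simp add: parity_states_def)

lemma finite_level_states: "finite (level_states D k)"
  using finite_states by (simp add: level_states_def)

lemma state_finite: "s \<in> states D \<Longrightarrow> finite s"
  using finite_subset[of s "{..<crossings D}"] by (simp add: states_def)

lemma num_a_b: "s \<in> states D \<Longrightarrow> int (num_a D s) = int (crossings D) - int (num_b s)"
  using card_mono[of "{..<crossings D}" s] by (simp add: states_def num_a_def num_b_def of_nat_diff)

lemma state_remove:
  assumes "t \<in> states D" "c \<in> t"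
  shows "t - {c} \<in> states D" "num_b t = Suc (num_b (t - {c}))"
  using assms card.remove[OF state_finite[OF assms(1)] assms(2)]
  by (auto simp only: states_def num_b_def)

lemma parity_states_remove:
  assumes "t \<in> parity_states D (1 - i)" "c \<in> t" "i < 2"
  shows "t - {c} \<in> parity_states D i"
proof -
  have t: "t \<in> states D" "(num_b t + size_sA D) mod 2 = 1 - i"
    using assms(1) by (auto simp: parity_states_def)
  have "(num_b (t - {c}) + size_sA D) mod 2 = i"
    using t(2) state_remove(2)[OF t(1) assms(2)] assms(3) by presburger
  then show ?thesis
    using state_remove(1)[OF t(1) assms(2)] by (simp add: parity_states_def)
qed

lemma level_states_remove:
  "t \<in> level_states D (k + 1) \<Longrightarrow> c \<in> t \<Longrightarrow> t - {c} \<in> level_states D k"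
  using state_remove[of t D c] by (auto simp: level_states_def)

text \<open>Since a - b = n - 2 b for n crossings, the total degrees match under the factor -2 if J
  - (n - 2 b) = -2 (q - b). The number b cancels, which leaves J = n - 2 q for every state.\<close>

lemma v_of_w_basis:
  assumes s: "s \<in> states D" and J: "J = int (crossings D) - 2 * q" and x: "x \<in> w_basis D J s"
  shows "(\<lambda>e\<in>circles D s. v_of_w (x e)) \<in> v_basis D q s"
proof -
  have "-2 * (\<Sum>e\<in>circles D s. v_deg (v_of_w (x e))) = (\<Sum>e\<in>circles D s. w_deg (x e))"
    by (simp add: w_deg_eq sum_distrib_left)
  also have "\<dots> = -2 * (q - int (num_b s))"
    using x J num_a_b[OF s] by (simp add: w_basis_def)
  finally show ?thesis by (simp add: v_basis_def)
qed

lemma w_of_v_basis: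
  assumes s: "s \<in> states D" and J: "J = int (crossings D) - 2 * q" and x: "x \<in> v_basis D q s"
  shows "(\<lambda>e\<in>circles D s. w_of_v (x e)) \<in> w_basis D J s"
proof -
  have "(\<Sum>e\<in>circles D s. w_deg (w_of_v (x e))) = -2 * (\<Sum>e\<in>circles D s. v_deg (x e))"
    by (simp add: w_deg_eq sum_distrib_left)
  also have "\<dots> = -2 * (q - int (num_b s))"
    using x by (simp add: v_basis_def)
  finally show ?thesis using J num_a_b[OF s] by (simp add: w_basis_def)
qed

text \<open>Here \<open>i\<close> is the index in the bracket before reflexing, and \<open>m\<close>
  will be \<open>n_minus D\<close>, the shift of the homological degree. The states with b(s) = k +
  m lie in \<open>S\<close> exactly when \<open>k\<close> is in \<open>K\<close>; a cycle or
  boundary of the folded complex is thus a family of cycles or boundaries, one for each such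
  \<open>k\<close>.\<close>

lemma cube_homology_iso:
  fixes i m :: nat
  assumes D: "oriented_link_diagram D" and J: "J = int (crossings D) - 2 * q" and i: "i < 2"
    and K: "K = {k. even (k + int m - int i - int (size_sA D))}"
  defines "S \<equiv> parity_states D i" and "T \<equiv> parity_states D (1 - i)"
  shows "homology_at (graded_sum T (W_state D) J) (cube_map W D S) (graded_sum S (W_state D) J)
      (cube_map W D T) (graded_sum T (W_state D) J)
    \<cong> sum_group K (\<lambda>k. Kh_cohomology D (k + int m) q)"
proof -
  define L where "L k = level_states D (k + int m)" for k
  define A where "A = w_basis D J"
  define B where "B = v_basis D q"
  define R where "R s = tensor_map v_of_w (circles D s)" for s
  define R' where "R' s = tensor_map w_of_v (circles D s)" for s
  define M where "M = {u \<in> families_in S A. cube_map W D T u = (\<lambda>t\<in>T. 0)}"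
  define H where "H = cube_map W D S ` families_in T A"
  define N where "N k = {v \<in> families_in (L k) B. cube_map V D (L (k + 1)) v = (\<lambda>t\<in>L (k + 1). 0)}" for k
  define I where "I k = cube_map V D (L k) ` families_in (L (k - 1)) B" for k
  define \<pi> where "\<pi> k u = (\<lambda>s\<in>L k. R s (u s))" for k u
  have finS: "finite S" "finite T" and finL: "finite (L k)" for k
    by (simp_all add: S_def T_def L_def finite_parity_states finite_level_states)
  have i': "1 - (1 - i) = i" "1 - i < 2" using i by auto
  have removeT: "t - {c} \<in> S" if "t \<in> T" "c \<in> t" for t c
    using parity_states_remove that i unfolding S_def T_def by blast
  have removeS: "s - {c} \<in> T" if "s \<in> S" "c \<in> s" for s c
    using parity_states_remove[of s D "1 - i" c] that i' unfolding S_def T_def by simp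
  have removeL: "t - {c} \<in> L (k - 1)" if "t \<in> L k" "c \<in> t" for t c k
    using level_states_remove[of t D "k - 1 + int m" c] that unfolding L_def
    by (simp add: algebra_simps)
  have removeL': "t - {c} \<in> L k" if "t \<in> L (k + 1)" "c \<in> t" for t c k
    using removeL[OF that] by simp
  have statesS: "s \<in> states D" if "s \<in> S" for s
    using that by (simp add: S_def parity_states_def)
  have statesT: "s \<in> states D" if "s \<in> T" for s
    using that by (simp add: T_def parity_states_def)
  have S_iff: "s \<in> S \<longleftrightarrow> s \<in> states D \<and> int (num_b s) - int m \<in> K" for s
  proof -
    have "(a + b) mod 2 = i \<longleftrightarrow> even (int a - int m + int m - int i - int b)" for a b :: nat
      using i by presburger
    then show ?thesis by (simp only: S_def parity_states_def K mem_Collect_eq)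
  qed
  have T_iff: "s \<in> T \<longleftrightarrow> s \<in> states D \<and> int (num_b s) + 1 - int m \<in> K" for s
  proof -
    have "(a + b) mod 2 = 1 - i \<longleftrightarrow> even (int a + 1 - int m + int m - int i - int b)" for a b :: nat
      using i by presburger
    then show ?thesis by (simp only: T_def parity_states_def K mem_Collect_eq)
  qed
  have L_iff: "s \<in> L k \<longleftrightarrow> s \<in> states D \<and> k = int (num_b s) - int m" for s k
    by (auto simp: L_def level_states_def)
  have K_shift: "k + 2 \<in> K \<longleftrightarrow> k \<in> K" for k
    by (simp add: K)
  have LS: "L k \<subseteq> S" if "k \<in> K" for k
    using that by (auto simp: S_iff L_iff)
  have LT': "L (k - 1) \<subseteq> T" if "k \<in> K" for k
  proof
    fix s assume "s \<in> L (k - 1)"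
    then have "s \<in> states D" "int (num_b s) + 1 - int m = k" by (simp_all add: L_iff)
    with that show "s \<in> T" by (simp add: T_iff)
  qed
  \<comment> \<open>\<open>K\<close> is closed under adding 2, so level \<open>k + 1\<close> is the
    level below \<open>k + 2\<close>.\<close>
  have LT: "L (k + 1) \<subseteq> T" if "k \<in> K" for k
    using LT'[of "k + 2"] that by (simp add: K_shift add.commute)
  have A_PiE: "A s \<subseteq> circles D s \<rightarrow>\<^sub>E UNIV" and B_PiE: "B s \<subseteq> circles D s \<rightarrow>\<^sub>E UNIV" for s
    by (auto simp: A_def B_def w_basis_def v_basis_def)
  have RA: "Poly_Mapping.keys (R s a) \<subseteq> B s" if "s \<in> states D" "Poly_Mapping.keys a \<subseteq> A s" for s a
    using keys_tensor_map[of v_of_w "circles D s" a] v_of_w_basis[OF that(1) J] that(2)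
    unfolding R_def A_def B_def by blast
  have RB: "Poly_Mapping.keys (R' s a) \<subseteq> A s" if "s \<in> states D" "Poly_Mapping.keys a \<subseteq> B s" for s a
    using keys_tensor_map[of w_of_v "circles D s" a] w_of_v_basis[OF that(1) J] that(2)
    unfolding R'_def A_def B_def by blast
  have R'R: "R' s (R s a) = a" if "Poly_Mapping.keys a \<subseteq> circles D s \<rightarrow>\<^sub>E UNIV" for s a
    unfolding R_def R'_def using that by (simp add: tensor_map_inverse)
  have RR': "R s (R' s a) = a" if "Poly_Mapping.keys a \<subseteq> circles D s \<rightarrow>\<^sub>E UNIV" for s a
    unfolding R_def R'_def using that by (simp add: tensor_map_inverse)
  have R0: "R s 0 = 0" "R' s 0 = 0" for s
    by (simp_all add: R_def R'_def)
  have natural: "cube_map V D T2 v t = R t (cube_map W D T1 u t)"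
    if "t \<in> states D" "t \<in> T1" "t \<in> T2"
      "\<And>c. c \<in> t \<Longrightarrow> Poly_Mapping.keys (u (t - {c})) \<subseteq> A (t - {c})"
      "\<And>c. c \<in> t \<Longrightarrow> v (t - {c}) = R (t - {c}) (u (t - {c}))" for t T1 T2 u v
    unfolding R_def
    by (rule tensor_map_cube_map[OF D]) (use that A_PiE in \<open>fastforce simp: R_def\<close>)+
  have fam: "Poly_Mapping.keys (u s) \<subseteq> C s" if "u \<in> families_in X C" "s \<in> X" for u s X and C :: "state \<Rightarrow> 'c set"
    using that by (auto simp: families_in_def PiE_iff)
  have \<pi>_fam: "(\<lambda>s\<in>L k. R s (u s)) \<in> families_in (L k) B"
    if "u \<in> families_in X A" "L k \<subseteq> X" for u k X
  proof -
    have "Poly_Mapping.keys (R s (u s)) \<subseteq> B s" if s: "s \<in> L k" for s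
      using RA[of s "u s"] fam[OF \<open>u \<in> families_in X A\<close>, of s] s \<open>L k \<subseteq> X\<close> L_iff by blast
    then show ?thesis by (simp add: families_in_def)
  qed
  have cube_ext: "cube_map F D X u \<in> extensional X" for F :: "'g graded_alg" and X u
    by (simp add: cube_map_def)

  have "homology_at (graded_sum T (W_state D) J) (cube_map W D S) (graded_sum S (W_state D) J)
      (cube_map W D T) (graded_sum T (W_state D) J) = (tensor_families S)\<lparr>carrier := M\<rparr> Mod H"
    unfolding graded_sum_W_state homology_at_families[OF finS]
    by (simp add: sum_group_free_Abelian_group finS M_def H_def A_def)
  moreover have "Kh_cohomology D (k + int m) q = (tensor_families (L k))\<lparr>carrier := N k\<rparr> Mod I k" for k
  proof -
    have shift: "k + int m - 1 = (k - 1) + int m" "k + int m + 1 = (k + 1) + int m" by simp_all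
    have level: "level_states D (k + int m) = L k" by (simp add: L_def)
    show ?thesis
      unfolding Kh_cohomology_def Kh_diff_def Kh_chain_def graded_sum_V_state shift L_def[symmetric]
        homology_at_families[OF finL finL]
      by (simp add: sum_group_free_Abelian_group finL N_def I_def B_def level)
  qed
  moreover have "(tensor_families S)\<lparr>carrier := M\<rparr> Mod H \<cong>
      sum_group K (\<lambda>k. (tensor_families (L k))\<lparr>carrier := N k\<rparr> Mod I k)"
  proof (rule Mod_iso_sum_group[where \<pi> = \<pi>])
    show "subgroup M (tensor_families S)"
      unfolding M_def by (rule subgroup_cycles) (rule removeT)
    show "subgroup H (tensor_families S)"
      unfolding H_def by (rule subgroup_boundaries) (rule removeS)
    show "subgroup (N k) (tensor_families (L k))" for k
      unfolding N_def by (rule subgroup_cycles) (rule removeL')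
    show "subgroup (I k) (tensor_families (L k))" for k
      unfolding I_def by (rule subgroup_boundaries) (rule removeL)
    show "\<pi> k \<in> hom (tensor_families S) (tensor_families (L k))" if k: "k \<in> K" for k
      using LS[OF k] by (intro homI) (auto simp: \<pi>_def R_def fun_eq_iff)
    show "\<pi> k u \<in> N k" if k: "k \<in> K" and u: "u \<in> M" for k u
    proof -
      have u': "u \<in> families_in S A" "cube_map W D T u = (\<lambda>t\<in>T. 0)"
        using u by (simp_all add: M_def)
      have "cube_map V D (L (k + 1)) (\<pi> k u) t = 0" if t: "t \<in> L (k + 1)" for t
      proof -
        have tT: "t \<in> T" using t LT[OF k] by blast
        have "cube_map V D (L (k + 1)) (\<pi> k u) t = R t (cube_map W D T u t)"
          by (rule natural)
            (use t tT statesT removeL' removeT fam[OF u'(1)] in \<open>auto simp: \<pi>_def\<close>)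
        then show ?thesis using u'(2) tT by (simp add: R0)
      qed
      then have "cube_map V D (L (k + 1)) (\<pi> k u) = (\<lambda>t\<in>L (k + 1). 0)"
        by (intro extensionalityI[OF cube_ext]) auto
      then show ?thesis
        unfolding N_def using \<pi>_fam[OF u'(1) LS[OF k]] by (simp add: \<pi>_def)
    qed
    show "u \<in> H \<longleftrightarrow> (\<forall>k\<in>K. \<pi> k u \<in> I k)" if u: "u \<in> M" for u
    proof
      assume "u \<in> H"
      then obtain z where z: "z \<in> families_in T A" "u = cube_map W D S z"
        by (auto simp: H_def)
      show "\<forall>k\<in>K. \<pi> k u \<in> I k"
      proof
        fix k assume k: "k \<in> K"
        let ?z = "\<lambda>s\<in>L (k - 1). R s (z s)"
        have "\<pi> k u = cube_map V D (L k) ?z"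
        proof (rule extensionalityI[OF _ cube_ext])
          show "\<pi> k u \<in> extensional (L k)" by (simp add: \<pi>_def)
          fix s assume s: "s \<in> L k"
          then have sS: "s \<in> S" using LS[OF k] by blast
          have "cube_map V D (L k) ?z s = R s (cube_map W D S z s)"
            by (rule natural)
              (use s sS statesS removeL removeS fam[OF z(1)] in \<open>auto\<close>)
          then show "\<pi> k u s = cube_map V D (L k) ?z s"
            using s z(2) by (simp add: \<pi>_def)
        qed
        moreover have "?z \<in> families_in (L (k - 1)) B"
          by (rule \<pi>_fam[OF z(1) LT'[OF k]])
        ultimately show "\<pi> k u \<in> I k" by (auto simp: I_def)
      qed
    next
      assume "\<forall>k\<in>K. \<pi> k u \<in> I k"
      then have "\<forall>k\<in>K. \<exists>z. z \<in> families_in (L (k - 1)) B \<and> \<pi> k u = cube_map V D (L k) z"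
        by (auto simp: I_def)
      then obtain z where z: "\<And>k. k \<in> K \<Longrightarrow> z k \<in> families_in (L (k - 1)) B"
          "\<And>k. k \<in> K \<Longrightarrow> \<pi> k u = cube_map V D (L k) (z k)"
        by metis
      \<comment> \<open>A state \<open>s\<close> of \<open>T\<close> lies in
        \<open>L (k - 1)\<close> for just one \<open>k\<close>, namely b(s) + 1 - m. Hence the
        preimages chosen for the various \<open>k\<close> fit together without conflict.\<close>
      define z' where "z' = (\<lambda>s\<in>T. R' s (z (int (num_b s) + 1 - int m) s))"
      have keys_z: "Poly_Mapping.keys (z (int (num_b s) + 1 - int m) s) \<subseteq> B s" if "s \<in> T" for s
        using that T_iff L_iff by (intro fam[OF z(1)]) auto
      have z'_fam: "z' \<in> families_in T A"
        using keys_z RB statesT by (auto simp: families_in_def z'_def)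
      have u': "u \<in> families_in S A" using u by (simp add: M_def)
      have "u = cube_map W D S z'"
      proof (rule extensionalityI[OF _ cube_ext])
        show "u \<in> extensional S" using u' by (simp add: families_in_def PiE_iff)
        fix s assume s: "s \<in> S"
        let ?k = "int (num_b s) - int m"
        have k: "?k \<in> K" and sL: "s \<in> L ?k"
          using s S_iff L_iff by auto
        have zs: "z ?k (s - {c}) = R (s - {c}) (z' (s - {c}))" if "c \<in> s" for c
        proof -
          have "s - {c} \<in> T" using removeS s that by blast
          moreover have "int (num_b (s - {c})) + 1 - int m = ?k"
            using state_remove(2)[OF statesS[OF s] that] by simp
          ultimately show ?thesis
            using keys_z[of "s - {c}"] B_PiE RR' by (simp add: z'_def subset_trans)
        qed
        have "R s (u s) = cube_map V D (L ?k) (z ?k) s"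
          using z(2)[OF k] sL by (metis \<pi>_def restrict_apply')
        also have "\<dots> = R s (cube_map W D S z' s)"
          by (rule natural)
            (use s sL statesS removeS fam[OF z'_fam] zs in auto)
        \<comment> \<open>Both arguments are supported on labellings of the circles of
          \<open>s\<close>, where \<open>R' s\<close> inverts \<open>R s\<close>.\<close>
        finally have "R' s (R s (u s)) = R' s (R s (cube_map W D S z' s))" by simp
        then show "u s = cube_map W D S z' s"
          using R'R[OF keys_cube_map[OF s]] R'R[OF subset_trans[OF fam[OF u' s] A_PiE]] by simp
      qed
      with z'_fam show "u \<in> H" by (simp add: H_def)
    qed
    show "finite {k \<in> K. \<pi> k u \<notin> I k}" if "u \<in> M" for u
    proof (rule finite_subset)
      show "finite ((\<lambda>s. int (num_b s) - int m) ` states D)"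
        using finite_states by simp
      \<comment> \<open>Over an empty level there is just one family, and it is the image of zero.
        So only the finitely many levels that occur can contribute.\<close>
      have "\<pi> k u \<in> I k" if "L k = {}" for k
      proof -
        have "(\<lambda>s\<in>L (k - 1). 0) \<in> families_in (L (k - 1)) B"
          by (simp add: families_in_def)
        moreover have "\<pi> k u = cube_map V D (L k) (\<lambda>s\<in>L (k - 1). 0)"
          using that by (simp add: \<pi>_def cube_map_def fun_eq_iff)
        ultimately show ?thesis by (auto simp: I_def)
      qed
      then show "{k \<in> K. \<pi> k u \<notin> I k} \<subseteq> (\<lambda>s. int (num_b s) - int m) ` states D"
        using L_iff by blast
    qed
    show "\<exists>u\<in>M. \<forall>k\<in>K. \<pi> k u = y k" if y: "\<And>k. k \<in> K \<Longrightarrow> y k \<in> N k" for y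
    proof -
      \<comment> \<open>The levels \<open>L k\<close> with \<open>k\<close> in \<open>K\<close>
        partition \<open>S\<close>, so cycles prescribed level by level define one family.\<close>
      define u where "u = (\<lambda>s\<in>S. R' s (y (int (num_b s) - int m) s))"
      have y_fam: "y k \<in> families_in (L k) B" if "k \<in> K" for k
        using y[OF that] by (simp add: N_def)
      have keys_y: "Poly_Mapping.keys (y (int (num_b s) - int m) s) \<subseteq> B s" if "s \<in> S" for s
        using that S_iff L_iff by (intro fam[OF y_fam]) auto
      have u_fam: "u \<in> families_in S A"
        using keys_y RB statesS by (auto simp: families_in_def u_def)
      have Ru: "R s (u s) = y (int (num_b s) - int m) s" if "s \<in> S" for s
        using that RR'[OF subset_trans[OF keys_y[OF that] B_PiE]] by (simp add: u_def)
      have "cube_map W D T u = (\<lambda>t\<in>T. 0)"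
      proof (rule extensionalityI[OF cube_ext])
        fix t assume t: "t \<in> T"
        \<comment> \<open>The value at \<open>t\<close> comes from one level lower, so
          \<open>t\<close> tests the cycle condition in degree b(t) - 1 - m.\<close>
        let ?k = "int (num_b t) - 1 - int m"
        have k: "?k \<in> K" and tL: "t \<in> L (?k + 1)"
          using t T_iff L_iff by (auto simp: K)
        have "y ?k (t - {c}) = R (t - {c}) (u (t - {c}))" if "c \<in> t" for c
          using Ru[OF removeT[OF t that]] state_remove(2)[OF statesT[OF t] that] by simp
        then have "cube_map V D (L (?k + 1)) (y ?k) t = R t (cube_map W D T u t)"
          by (intro natural) (use t tL statesT removeT fam[OF u_fam] in auto)
        moreover have "cube_map V D (L (?k + 1)) (y ?k) t = 0"
          using y[OF k] tL by (simp add: N_def)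
        ultimately have "R' t (R t (cube_map W D T u t)) = 0"
          by (simp add: R0)
        then show "cube_map W D T u t = (\<lambda>t\<in>T. 0) t"
          using R'R[OF keys_cube_map[OF t]] t by simp
      qed simp
      then have "u \<in> M" using u_fam by (simp add: M_def)
      moreover have "\<pi> k u = y k" if k: "k \<in> K" for k
      proof (rule extensionalityI)
        show "\<pi> k u \<in> extensional (L k)" by (simp add: \<pi>_def)
        show "y k \<in> extensional (L k)"
          using y_fam[OF k] by (simp add: families_in_def PiE_iff)
        show "\<pi> k u s = y k s" if s: "s \<in> L k" for s
          using Ru[of s] LS[OF k] s L_iff[of s k] by (auto simp: \<pi>_def)
      qed
      ultimately show ?thesis by blast
    qed
  qed (simp_all add: comm_group_tensor_families)
  ultimately show ?thesis by simp
qed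

section \<open>Normalisation by the writhe, vanishing, and the final comparison\<close>

lemma H2_eq:
  assumes "i \<in> {0, 1}"
  obtains i' where "i' < 2" "even (int i' - (int i + writhe D))"
    "H2 D i j = homology_at (graded_sum (parity_states D (1 - i')) (W_state D) (j + 3 * writhe D))
      (cube_map W D (parity_states D i'))
      (graded_sum (parity_states D i') (W_state D) (j + 3 * writhe D))
      (cube_map W D (parity_states D (1 - i')))
      (graded_sum (parity_states D (1 - i')) (W_state D) (j + 3 * writhe D))"
proof
  \<comment> \<open>An odd writhe exchanges the two parts. The shift by -3 w means that degree j is
    degree j + 3 w of the bracket.\<close>
  let ?i' = "if even (writhe D) then i else 1 - i"
  show "?i' < 2" "even (int ?i' - (int i + writhe D))"
    using assms by auto
  show "H2 D i j = homology_at (graded_sum (parity_states D (1 - ?i')) (W_state D) (j + 3 * writhe D))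
      (cube_map W D (parity_states D ?i'))
      (graded_sum (parity_states D ?i') (W_state D) (j + 3 * writhe D))
      (cube_map W D (parity_states D (1 - ?i')))
      (graded_sum (parity_states D (1 - ?i')) (W_state D) (j + 3 * writhe D))"
    using assms
    by (auto simp: H2_def C2_def homology2_def shift2_def shift_def reflex_pow_def reflex_def bracket2_def)
qed

lemma H2_iso_Kh:
  assumes D: "oriented_link_diagram D" and i: "i \<in> {0, 1}" and j: "even j"
  shows "H2 D i j \<cong> sum_group {k. even (k - (int i + int (n_plus D) + int (size_sA D)))}
    (\<lambda>k. Kh D k (- (j div 2)))"
proof -
  obtain i' where i': "i' < 2" "even (int i' - (int i + writhe D))"
    "H2 D i j = homology_at (graded_sum (parity_states D (1 - i')) (W_state D) (j + 3 * writhe D))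
      (cube_map W D (parity_states D i'))
      (graded_sum (parity_states D i') (W_state D) (j + 3 * writhe D))
      (cube_map W D (parity_states D (1 - i')))
      (graded_sum (parity_states D (1 - i')) (W_state D) (j + 3 * writhe D))"
    using H2_eq[OF i] by blast
  let ?q = "- (j div 2) - int (n_plus D) + 2 * int (n_minus D)"
  \<comment> \<open>Modulo 2, \<open>i'\<close> is i + n_+ - n_-, so the number of negative
    crossings cancels.\<close>
  have "even (k + int (n_minus D) - int i' - int (size_sA D)) \<longleftrightarrow>
      even (k - (int i + int (n_plus D) + int (size_sA D)))" for k
    using i'(2) unfolding writhe_def by presburger
  then have K: "{k. even (k - (int i + int (n_plus D) + int (size_sA D)))} =
      {k. even (k + int (n_minus D) - int i' - int (size_sA D))}"
    by blast
  \<comment> \<open>With \<open>?q\<close> from the normalisation of \<open>Kh\<close> at l = -j/2,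
    n - 2 q equals n_+ + n_- + j + 2 n_+ - 4 n_-, that is, j + 3 (n_+ - n_-).\<close>
  have "j + 3 * writhe D = int (crossings D) - 2 * ?q"
    using j by (auto simp: writhe_def crossings_eq)
  from cube_homology_iso[OF D this i'(1) K] show ?thesis
    unfolding i'(3) Kh_def .
qed

lemma v_deg_sum_parity: "finite X \<Longrightarrow> even ((\<Sum>e\<in>X. v_deg (x e)) + int (card X))"
proof (induction X rule: finite_induct)
  case (insert e X)
  then show ?case by (cases "x e") auto
qed simp

lemma finite_circles: "finite (circles D s)"
  by (simp add: circles_def orbs_def)

text \<open>A sum of signs over the circles has the parity of their number, so a generator forces q
  - b(s) and |s| to have equal parity. As |s| + b(s) has the parity of |s_A|, and q that of j/2 +
  n_+, the chain groups themselves vanish when j/2 + n_+ + |s_A| is odd.\<close>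

lemma w_basis_empty:
  assumes D: "oriented_link_diagram D" and s: "s \<in> states D" and j: "even j"
    and odd: "odd (j div 2 + int (n_plus D + size_sA D))"
  shows "w_basis D (j + 3 * writhe D) s = {}"
proof (rule ccontr)
  let ?q = "- (j div 2) - int (n_plus D) + 2 * int (n_minus D)"
  assume "w_basis D (j + 3 * writhe D) s \<noteq> {}"
  then obtain x where x: "x \<in> w_basis D (j + 3 * writhe D) s" by blast
  have "j + 3 * writhe D = int (crossings D) - 2 * ?q"
    using j by (auto simp: writhe_def crossings_eq)
  then have "(\<Sum>e\<in>circles D s. v_deg ((\<lambda>e\<in>circles D s. v_of_w (x e)) e)) = ?q - int (num_b s)"
    using v_of_w_basis[OF s _ x] by (simp add: v_basis_def)
  then have "even (?q - int (num_b s) + int (card (circles D s)))"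
    using v_deg_sum_parity[OF finite_circles, of "\<lambda>e\<in>circles D s. v_of_w (x e)"] by metis
  moreover have "even (int (card (circles D s)) + int (num_b s)) \<longleftrightarrow> even (int (size_sA D))"
    using circles_parity[OF D s] by simp
  ultimately show False
    using odd by simp presburger
qed

lemma H2_trivial:
  assumes D: "oriented_link_diagram D" and i: "i \<in> {0, 1}" and j: "even j"
    and odd: "odd (j div 2 + int (n_plus D + size_sA D))"
  shows "trivial_group (H2 D i j)"
proof -
  obtain i' where i': "i' < 2"
    "H2 D i j = homology_at (graded_sum (parity_states D (1 - i')) (W_state D) (j + 3 * writhe D))
      (cube_map W D (parity_states D i'))
      (graded_sum (parity_states D i') (W_state D) (j + 3 * writhe D))
      (cube_map W D (parity_states D (1 - i')))
      (graded_sum (parity_states D (1 - i')) (W_state D) (j + 3 * writhe D))"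
    using H2_eq[OF i] by blast
  define S where "S = parity_states D i'"
  define T where "T = parity_states D (1 - i')"
  define A where "A = w_basis D (j + 3 * writhe D)"
  define M where "M = {u \<in> families_in S A. cube_map W D T u = (\<lambda>t\<in>T. 0)}"
  define H where "H = cube_map W D S ` families_in T A"
  have fin: "finite S" "finite T"
    by (simp_all add: S_def T_def finite_parity_states)
  have eq: "H2 D i j = (tensor_families S)\<lparr>carrier := M\<rparr> Mod H"
    unfolding i'(2) S_def[symmetric] T_def[symmetric] graded_sum_W_state homology_at_families[OF fin]
    by (simp add: sum_group_free_Abelian_group fin M_def H_def A_def)
  have removeT: "t - {c} \<in> S" if "t \<in> T" "c \<in> t" for t c
    using parity_states_remove that i'(1) unfolding S_def T_def by blast
  have removeS: "s - {c} \<in> T" if "s \<in> S" "c \<in> s" for s c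
    using parity_states_remove[of s D "1 - i'" c] that i'(1) unfolding S_def T_def by simp
  have M: "subgroup M (tensor_families S)"
    unfolding M_def by (rule subgroup_cycles) (rule removeT)
  have H: "subgroup H (tensor_families S)"
    unfolding H_def by (rule subgroup_boundaries) (rule removeS)
  note Q = comm_group.Mod_carrier_update_hom[OF comm_group_tensor_families M H]
  have "A s = {}" if "s \<in> S" for s
    using w_basis_empty[OF D _ j odd, of s] that by (simp add: A_def S_def parity_states_def)
  then have "families_in S A \<subseteq> {\<lambda>s\<in>S. 0}"
    by (auto simp: families_in_def PiE_iff extensional_def fun_eq_iff)
  then have "M \<subseteq> {\<lambda>s\<in>S. 0}" by (auto simp: M_def)
  then have "carrier (H2 D i j) \<subseteq> {H #>\<^bsub>tensor_families S\<^esub> (\<lambda>s\<in>S. 0)}"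
    unfolding eq Q(3)[symmetric] by blast
  then show ?thesis
    using group.trivial_group_alt[OF Q(1)] unfolding eq by blast
qed

lemma trivial_groups_iso:
  assumes "trivial_group G" "trivial_group H"
  shows "G \<cong> H"
proof -
  have "(\<lambda>x. \<one>\<^bsub>H\<^esub>) \<in> iso G H"
    using assms unfolding trivial_group_def
    by (intro isoI homI) (auto simp: bij_betw_def group.is_monoid)
  then show ?thesis by (rule is_isoI)
qed

text \<open>In these degrees the homology vanishes for both indices, so the isomorphism for the
  index \<open>1 - i\<close> also serves \<open>i\<close>. This permits the opposite parity of
  \<open>k\<close>.\<close>

lemma H2_iso_trivial:
  assumes D: "oriented_link_diagram D" and i: "i \<in> {0, 1}" and j: "even j"
    and odd: "odd (j div 2 + int (n_plus D + size_sA D))"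
  shows "H2 D i j \<cong> sum_group {k. even (k - (int (1 - i) + int (n_plus D) + int (size_sA D)))}
    (\<lambda>k. Kh D k (- (j div 2)))"
proof -
  have i': "1 - i \<in> {0, 1}" by auto
  have "H2 D i j \<cong> H2 D (1 - i) j"
    using H2_trivial[OF D i j odd] H2_trivial[OF D i' j odd] by (rule trivial_groups_iso)
  then show ?thesis
    using H2_iso_Kh[OF D i' j] by (rule iso_trans)
qed

theorem theorem6p3:
  fixes D :: link_diagram and N :: nat
  assumes "oriented_link_diagram D"
    and "N = num_components D"
  shows "(\<forall>i\<in>{0, 1}. \<forall>j. even j \<longrightarrow>
      (4 dvd j \<longrightarrow>
        H2 D i j \<cong> sum_group {k. even (k - int i)} (\<lambda>k. Kh D k (- (j div 2)))) \<and>
      (\<not> 4 dvd j \<longrightarrow>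
        H2 D i j \<cong> sum_group {k. even (k - (int i + 1))} (\<lambda>k. Kh D k (- (j div 2))))) \<and>
    (\<forall>i\<in>{0, 1}. \<forall>j. even j \<longrightarrow>
      H2 D i j \<cong> sum_group {k. even (k - (int i + int (n_plus D) + int (size_sA D)))}
                   (\<lambda>k. Kh D k (- (j div 2)))) \<and>
    (odd N \<longrightarrow> odd (n_plus D + size_sA D) \<and>
      (\<forall>i\<in>{0, 1}. \<forall>j. 4 dvd j \<longrightarrow> trivial_group (H2 D i j))) \<and>
    (even N \<longrightarrow> even (n_plus D + size_sA D) \<and>
      (\<forall>i\<in>{0, 1}. \<forall>j. 4 dvd (j - 2) \<longrightarrow> trivial_group (H2 D i j)))"
proof -
  note D = assms(1)
  have N: "even N \<longleftrightarrow> even (n_plus D + size_sA D)"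
    using components_parity[OF D] assms(2) by simp
  \<comment> \<open>The common form of both cases: the parity of i + j/2 is that of i if 4 divides
    j, and that of i + 1 otherwise.\<close>
  have same: "H2 D i j \<cong> sum_group {k. even (k - r)} (\<lambda>k. Kh D k (- (j div 2)))"
    if i: "i \<in> {0, 1}" and j: "even j" and r: "even (r - (int i + j div 2))" for i j r
  proof (cases "odd (j div 2 + int (n_plus D + size_sA D))")
    case True
    have "{k. even (k - r)} = {k. even (k - (int (1 - i) + int (n_plus D) + int (size_sA D)))}"
      using True r i by auto
    then show ?thesis using H2_iso_trivial[OF D i j True] by simp
  next
    case False
    have "even (k - r) \<longleftrightarrow> even (k - (int i + int (n_plus D) + int (size_sA D)))" for k
      using False r by simp presburger
    then show ?thesis using H2_iso_Kh[OF D i j] by simp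
  qed
  have "H2 D i j \<cong> sum_group {k. even (k - int i)} (\<lambda>k. Kh D k (- (j div 2)))"
    if "i \<in> {0, 1}" "even j" "4 dvd j" for i j
    by (rule same[OF that(1,2)]) (use that(3) in presburger)
  moreover have "H2 D i j \<cong> sum_group {k. even (k - (int i + 1))} (\<lambda>k. Kh D k (- (j div 2)))"
    if "i \<in> {0, 1}" "even j" "\<not> 4 dvd j" for i j
    by (rule same[OF that(1,2)]) (use that(2,3) in presburger)
  moreover note H2_iso_Kh[OF D]
  moreover have "trivial_group (H2 D i j)" if "odd N" "i \<in> {0, 1}" "4 dvd j" for i j
    by (rule H2_trivial[OF D that(2)]) (use that N in presburger)+
  moreover have "trivial_group (H2 D i j)" if "even N" "i \<in> {0, 1}" "4 dvd (j - 2)" for i j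
    by (rule H2_trivial[OF D that(2)]) (use that N in presburger)+
  ultimately show ?thesis
    using N by (intro conjI ballI allI impI) metis+
qed

end
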